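(* Every Šunić group (for any prime $p$ and any admissible defining polynomial) is just infinite, i.e. it is infinite and all of its proper quotients are finite.
   Context: Let $p$ be a prime, $X=\{\mathbf 0,\dots,\mathbf{p-1}\}$ and $T$ the $p$-regular rooted tree with vertex set $X^*$ (finite words; $w$ is joined to $wx$ for $x\in X$). For $g\in\mathrm{Aut}\,T$ and a vertex $v$, $g_v\in\mathrm{Aut}\,T$ is the unique automorphism with $g(vw)=g(v)g_v(w)$ for all $w$; if $g$ fixes the first level $X$ pointwise, write $\psi(g)=(g_{\mathbf 0},\dots,g_{\mathbf{p-1}})$. A proper quotient is a quotient by a non-trivial normal subgroup. Šunić groups: let $f(x)=x^m+a_{m-1}x^{m-1}+\dots+a_1x+a_0\in\mathbb F_p[x]$ with $m\ge1$, $a_0\ne0$. Let $B\cong(\mathbb Z/p)^m$ be written multiplicatively with basis $b_0,\dots,b_{m-1}$; let $\rho\colon B\to B$ be the automorphism with $\rho(b_i)=b_{i+1}$ for $0\le i\le m-2$ and $\rho(b_{m-1})=b_0^{-a_0}b_1^{-a_1}\cdots b_{m-1}^{-a_{m-1}}$. Let $A=\langle a\rangle$ be cyclic of order $p$ and $\omega\colon B\to A$ the homomorphism with $\omega(b_i)=1$ for $i\le m-2$ and $\omega(b_{m-1})=a$. Then $a$ acts on $T$ by $a(xw)=\sigma(x)w$ for $x\in X$, where $\sigma=(\mathbf 0\ \mathbf 1\ \dots\ \mathbf{p-1})$, and $y\in B$ acts recursively by fixing the first level with $\psi(y)=(\omega(y),1,\dots,1,\rho(y))$. These actions are faithful, and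 the Šunić group is $G_{p,f}:=\langle A\cup B\rangle\le\mathrm{Aut}\,T$. *)

theory Defs
  imports
    "Berlekamp_Zassenhaus.Finite_Field"
    "Jordan_Normal_Form.Matrix"
    "HOL-Algebra.Generated_Groups"
begin

text \<open>
  The prime \<open>p\<close> is \<open>CARD('p)\<close> for a type \<open>'p :: prime_card\<close>, and \<open>'p mod_ring\<close> is the
  field with \<open>p\<close> elements. It also serves as the alphabet \<open>X\<close>, its elements
  \<open>0, 1, \<dots>, -1\<close> being the letters \<open>\<zero>, \<one>, \<dots>, p-1\<close>.
\<close>

section \<open>The regular rooted tree\<close>

text \<open>The vertices are all finite words over the type \<open>'x\<close>; the root is \<open>[]\<close>.\<close>

definition tree_adj :: "'x list \<Rightarrow> 'x list \<Rightarrow> bool" where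
  "tree_adj u v \<longleftrightarrow> (\<exists>x. v = u @ [x] \<or> u = v @ [x])"

definition aut_tree :: "('x list \<Rightarrow> 'x list) monoid" where
  "aut_tree =
     \<lparr>carrier = {g. bij g \<and> g [] = [] \<and> (\<forall>u v. tree_adj (g u) (g v) \<longleftrightarrow> tree_adj u v)},
      monoid.mult = (\<circ>), one = id\<rparr>"

section \<open>The groups \<open>A\<close> and \<open>B\<close> and their actions\<close>

text \<open>
  \<open>A\<close> is the additive group of \<open>'p mod_ring\<close>, where \<open>k\<close> stands for \<open>a\<^sup>k\<close>. Since \<open>a\<close> acts
  on the first level by the cycle \<open>x \<mapsto> x + 1\<close>, its power \<open>a\<^sup>k\<close> acts by \<open>x \<mapsto> x + k\<close>.
\<close>

fun act_A :: "'p::prime_card mod_ring \<Rightarrow> 'p mod_ring list \<Rightarrow> 'p mod_ring list" where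
  "act_A k [] = []"
| "act_A k (x # w) = (x + k) # w"

text \<open>
  With \<open>m = degree f\<close>, the group \<open>B\<close> is \<open>carrier_vec m\<close> under addition: the vector \<open>c\<close>
  stands for the product of the powers of the \<open>b\<^sub>i\<close> with exponents \<open>c $ i\<close>, so \<open>b\<^sub>i\<close> is
  \<open>unit_vec m i\<close>. The homomorphism \<open>\<rho>\<close> is the linear map whose matrix has as its \<open>i\<close>-th
  column the prescribed image of \<open>b\<^sub>i\<close>; \<open>\<omega>\<close> reads off the exponent of \<open>b\<^sub>m\<^sub>-\<^sub>1\<close> and returns it
  as an exponent of \<open>a\<close>.
\<close>

definition rho_basis :: "'p::prime_card mod_ring poly \<Rightarrow> nat \<Rightarrow> 'p mod_ring vec" where
  "rho_basis f i =
     (let m = degree f in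
      if i + 1 < m then unit_vec m (i + 1) else vec m (\<lambda>j. - coeff f j))"

definition rho :: "'p::prime_card mod_ring poly \<Rightarrow> 'p mod_ring vec \<Rightarrow> 'p mod_ring vec" where
  "rho f c = mat_of_cols (degree f) (map (rho_basis f) [0..<degree f]) *\<^sub>v c"

definition omega :: "'p::prime_card mod_ring poly \<Rightarrow> 'p mod_ring vec \<Rightarrow> 'p mod_ring" where
  "omega f c = c $ (degree f - 1)"

text \<open>The recursion \<open>\<psi>(y) = (\<omega>(y), 1, \<dots>, 1, \<rho>(y))\<close>; the last letter \<open>p-1\<close> is \<open>-1\<close>.\<close>

fun act_B :: "'p::prime_card mod_ring poly \<Rightarrow> 'p mod_ring vec
    \<Rightarrow> 'p mod_ring list \<Rightarrow> 'p mod_ring list" where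
  "act_B f c [] = []"
| "act_B f c (x # w) =
     (if x = 0 then x # act_A (omega f c) w
      else if x = - 1 then x # act_B f (rho f c) w
      else x # w)"

definition sunic_group ::
    "'p::prime_card mod_ring poly \<Rightarrow> ('p mod_ring list \<Rightarrow> 'p mod_ring list) monoid" where
  "sunic_group f =
     aut_tree\<lparr>carrier := generate aut_tree (range act_A \<union> act_B f ` carrier_vec (degree f))\<rparr>"

section \<open>Just infinite groups\<close>

definition just_infinite :: "('g, 'h) monoid_scheme \<Rightarrow> bool" where
  "just_infinite G \<longleftrightarrow>
     group G \<and> infinite (carrier G) \<and>
     (\<forall>N. N \<lhd> G \<and> N \<noteq> {\<one>\<^bsub>G\<^esub>} \<longrightarrow> finite (carrier (G Mod N)))"

section \<open>Well-definedness\<close>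

lemma rho_unit_vec:
  assumes "i < degree f"
  shows "rho f (unit_vec (degree f) i) = rho_basis f i"
  using assms unfolding rho_def
  by (intro eq_vecI) (auto simp: rho_basis_def Let_def mat_of_cols_index row_def)

lemma group_aut_tree: "group (aut_tree :: ('x list \<Rightarrow> 'x list) monoid)"
proof (rule groupI)
  fix g :: "'x list \<Rightarrow> 'x list" assume g: "g \<in> carrier aut_tree"
  then have b: "bij g" by (simp add: aut_tree_def)
  have "inv_into UNIV g \<in> carrier aut_tree"
    using g b unfolding aut_tree_def
    by (simp add: bij_imp_bij_inv) (metis bij_inv_eq_iff)
  moreover have "inv_into UNIV g \<circ> g = id" using b by (simp add: bij_is_inj)
  ultimately show "\<exists>h\<in>carrier aut_tree. h \<otimes>\<^bsub>aut_tree\<^esub> g = \<one>\<^bsub>aut_tree\<^esub>"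
    by (auto simp: aut_tree_def intro!: bexI[of _ "inv_into UNIV g"])
qed (auto simp: aut_tree_def bij_comp o_assoc)

lemma aut_treeI:
  assumes "bij g" "g [] = []"
    and prefix: "\<And>u x. \<exists>y. g (u @ [x]) = g u @ [y]"
  shows "g \<in> carrier aut_tree"
proof -
  have len: "length (g u) = length u" for u
  proof (induction u rule: rev_induct)
    case (snoc x u) then show ?case using prefix[of u x] by auto
  qed (simp add: assms)
  have step: "\<exists>x. v = u @ [x]" if e: "g v = g u @ [y]" for u v y
  proof -
    from e have "length v = Suc (length u)" using len[of u] len[of v] by simp
    then obtain u' x where v: "v = u' @ [x]" by (metis length_Suc_conv_rev)
    then have "g u' = g u" using e prefix[of u' x] by auto
    then show ?thesis using v \<open>bij g\<close> by (metis bij_inv_eq_iff)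
  qed
  have "tree_adj (g u) (g v) \<longleftrightarrow> tree_adj u v" for u v
    unfolding tree_adj_def using prefix step by metis
  with assms show ?thesis by (simp add: aut_tree_def)
qed

lemma act_A_aut: "act_A k \<in> carrier aut_tree"
proof (rule aut_treeI)
  have "act_A (- k) (act_A k w) = w" "act_A k (act_A (- k) w) = w" for w
    by (cases w; simp)+
  then show "bij (act_A k)" by (metis bijI')
  show "\<exists>y. act_A k (u @ [x]) = act_A k u @ [y]" for u x
    by (cases u) auto
qed simp

lemma act_B_aut: "act_B f c \<in> carrier aut_tree"
proof (rule aut_treeI)
  have A: "bij (act_A k)" for k :: "'a mod_ring"
    using act_A_aut[of k] by (simp add: aut_tree_def)
  have inj: "act_B f c v = act_B f c w \<Longrightarrow> v = w" for v w
  proof (induction v arbitrary: c w)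
    case Nil then show ?case by (cases w) (auto split: if_splits)
  next
    case (Cons x v)
    then show ?case using A by (cases w) (auto split: if_splits dest: bij_is_inj injD)
  qed
  have surj: "\<exists>v. w = act_B f c v" for w
  proof (induction w arbitrary: c)
    case Nil then show ?case by (metis act_B.simps(1))
  next
    case (Cons x w)
    obtain u where u: "w = act_A (omega f c) u" using A by (metis bij_pointE)
    obtain v where v: "w = act_B f (rho f c) v" using Cons by blast
    show ?case
      using u v by (intro exI[of _ "if x = 0 then x # u else if x = -1 then x # v else x # w"]) auto
  qed
  show "bij (act_B f c)" using inj surj by (metis bijI')
  show "\<exists>y. act_B f c (u @ [x]) = act_B f c u @ [y]" for u x
  proof (induction u arbitrary: c)
    case (Cons z u)
    have "\<exists>y. act_A k (u @ [x]) = act_A k u @ [y]" for k by (cases u) auto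
    with Cons show ?case by auto
  qed auto
qed simp

lemma group_sunic_group: "group (sunic_group f)"
proof -
  have "range act_A \<union> act_B f ` carrier_vec (degree f) \<subseteq> carrier aut_tree"
    using act_A_aut act_B_aut by blast
  then show ?thesis
    unfolding sunic_group_def
    by (intro subgroup.subgroup_is_group group.generate_is_subgroup group_aut_tree)
qed

end

theory Submission imports Defs begin

text \<open>
  Let \<open>K\<close> be the normal closure of the commutators \<open>[a, y]\<close> with \<open>y \<in> C\<close>, where \<open>C = B\<close> for odd \<open>p\<close>
  and \<open>C = \<rho>(ker \<omega>)\<close> for \<open>p = 2\<close>. If \<open>\<omega>(b) = a\<close> and \<open>y = \<rho>(c)\<close>, the commutator of \<open>b\<close> with the
  conjugate of \<open>c\<close> by \<open>a\<close> has the section \<open>[a, y]\<close> at the letter \<open>0\<close> and trivial sections elsewhere;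
  it lies in \<open>K\<close> when \<open>b \<in> C\<close>. Hence \<open>K\<close> contains its copies below all vertices, and a nontrivial
  normal subgroup contains the copies of \<open>K'\<close> below all vertices of some level. So it suffices
  that \<open>K'\<close> has finite index. For odd \<open>p\<close> the sections of elements of \<open>K\<close> at a fixed letter give the
  whole group, so \<open>K'\<close> contains a copy of \<open>[G, K]\<close> below each letter, and modulo \<open>[G, K]\<close>
  the commutators \<open>[a, y]\<close> are central. For \<open>p = 2\<close> and \<open>m \<ge> 2\<close> the group modulo \<open>K\<close> is a quotient of
  the product of a dihedral group of order 8 with \<open>C\<close>, and \<open>K/K'\<close> is a finitely generated abelian
  group generated by torsion elements: \<open>a y\<close> has finite order for \<open>y \<in> C\<close>, because \<open>\<rho>\<close> is periodic
  and so \<open>\<omega>\<close> vanishes at some \<open>\<rho>\<^sup>i(y)\<close>. The remaining group is dihedral.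
\<close>

section \<open>Finite quotients\<close>

lemma (in group) inv_mult_cancel:
  assumes "x \<in> carrier G" "y \<in> carrier G"
  shows "inv x \<otimes> (x \<otimes> y) = y" "x \<otimes> (inv x \<otimes> y) = y"
  using assms by (simp_all add: m_assoc[symmetric])

lemma (in group) nat_pow_conjugate:
  assumes g: "g \<in> carrier G" and x: "x \<in> carrier G"
  shows "(g \<otimes> x \<otimes> inv g) [^] (n::nat) = g \<otimes> x [^] n \<otimes> inv g"
proof (induction n)
  case (Suc n)
  then show ?case using g x by (simp add: m_assoc inv_mult_cancel)
qed (use g in simp)

lemma (in group) normal_generate_conjugates:
  assumes E: "E \<subseteq> carrier G"
  shows "generate G (\<Union>g\<in>carrier G. (\<lambda>e. g \<otimes> e \<otimes> inv g) ` E) \<lhd> G"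
proof (rule normal_generateI)
  show "(\<Union>g\<in>carrier G. (\<lambda>e. g \<otimes> e \<otimes> inv g) ` E) \<subseteq> carrier G" using E by auto
next
  fix h g assume "h \<in> (\<Union>g\<in>carrier G. (\<lambda>e. g \<otimes> e \<otimes> inv g) ` E)" and g: "g \<in> carrier G"
  then obtain k e where k: "k \<in> carrier G" "e \<in> E" "h = k \<otimes> e \<otimes> inv k" by auto
  then have "g \<otimes> h \<otimes> inv g = (g \<otimes> k) \<otimes> e \<otimes> inv (g \<otimes> k)"
    using g E by (auto simp: m_assoc inv_mult_group)
  then show "g \<otimes> h \<otimes> inv g \<in> (\<Union>g\<in>carrier G. (\<lambda>e. g \<otimes> e \<otimes> inv g) ` E)"
    using g k by blast
qed

text \<open>Modulo \<open>H\<close> the element \<open>b\<close> commutes with \<open>a\<close> and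
  with \<open>c\<close>, hence with the conjugate of \<open>c\<close> by \<open>a\<close>. Inside
  the group, with k = [a, b], this becomes the identity [b, d] =
  \<open>inv k \<otimes> (d \<otimes> k \<otimes> inv d)\<close>.\<close>

lemma (in normal) commutator_conjugate_in:
  assumes "a \<in> carrier G" "b \<in> carrier G" "c \<in> carrier G"
    and "a \<otimes> b \<otimes> inv a \<otimes> inv b \<in> H" and bc: "b \<otimes> c = c \<otimes> b"
  shows "b \<otimes> (a \<otimes> c \<otimes> inv a) \<otimes> inv b \<otimes> inv (a \<otimes> c \<otimes> inv a) \<in> H"
proof -
  define k where "k = a \<otimes> b \<otimes> inv a \<otimes> inv b"
  define d where "d = a \<otimes> c \<otimes> inv a"
  have k: "k \<in> H" and d: "d \<in> carrier G" using assms by (simp_all add: k_def d_def)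
  have ba: "k \<otimes> (b \<otimes> a) = a \<otimes> b" using assms by (simp add: k_def m_assoc inv_mult_cancel)
  have "k \<otimes> (b \<otimes> d) = (k \<otimes> (b \<otimes> a)) \<otimes> c \<otimes> inv a"
    using assms k by (simp add: d_def m_assoc inv_mult_cancel)
  also have "\<dots> = a \<otimes> (b \<otimes> c) \<otimes> inv a"
    unfolding ba using assms by (simp add: m_assoc inv_mult_cancel)
  also have "\<dots> = d \<otimes> (a \<otimes> b \<otimes> inv a)"
    unfolding bc using assms by (simp add: d_def m_assoc inv_mult_cancel)
  also have "a \<otimes> b \<otimes> inv a = k \<otimes> b"
    using assms by (simp add: k_def m_assoc inv_mult_cancel)
  finally have eq: "k \<otimes> (b \<otimes> d) = d \<otimes> (k \<otimes> b)" .
  have "b \<otimes> d \<otimes> inv b \<otimes> inv d = inv k \<otimes> (k \<otimes> (b \<otimes> d)) \<otimes> inv b \<otimes> inv d"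
    using k d assms by (simp add: m_assoc inv_mult_cancel)
  also have "\<dots> = inv k \<otimes> (d \<otimes> k \<otimes> inv d)"
    unfolding eq using k d assms by (simp add: m_assoc inv_mult_cancel)
  also have "\<dots> \<in> H" using k inv_op_closed2[OF d k] by simp
  finally show ?thesis by (simp add: d_def)
qed

text \<open>Serves for sets \<open>X\<close> of normal forms, whose closure under products is not
  clear in advance. The induction on \<open>g\<close> treats all \<open>x\<close> at once, since a
  product is absorbed factor by factor.\<close>

lemma (in group) generate_subset_if_right_closed:
  assumes S: "S \<subseteq> carrier G" and X: "X \<subseteq> carrier G" "\<one> \<in> X"
    and closed: "\<And>x s. x \<in> X \<Longrightarrow> s \<in> S \<Longrightarrow> x \<otimes> s \<in> X"
    and closed_inv: "\<And>x s. x \<in> X \<Longrightarrow> s \<in> S \<Longrightarrow> x \<otimes> inv s \<in> X"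
  shows "generate G S \<subseteq> X"
proof
  fix g assume g: "g \<in> generate G S"
  have "x \<otimes> g \<in> X" if "x \<in> X" for x
    using g that
  proof (induction g arbitrary: x rule: generate.induct)
    case (eng h1 h2)
    have "h1 \<in> carrier G" "h2 \<in> carrier G"
      using eng.hyps generate_in_carrier[OF S] by auto
    moreover have "x \<in> carrier G" using X eng.prems by auto
    ultimately have "x \<otimes> (h1 \<otimes> h2) = (x \<otimes> h1) \<otimes> h2" by (simp add: m_assoc)
    then show ?case using eng by simp
  qed (use X closed closed_inv in auto)
  from this[OF X(2)] show "g \<in> X" using g generate_in_carrier[OF S] by simp
qed

lemma (in group) finite_range_torsion:
  assumes x: "x \<in> carrier G" and n: "n > (0::nat)" "x [^] n = \<one>"
  shows "finite (range (\<lambda>j::int. x [^] j))"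
proof -
  have eq: "x [^] j = x [^] (j mod int n)" for j :: int
  proof -
    have "x [^] (int n * (j div int n)) = \<one>"
      using x n by (metis int_pow_int int_pow_one int_pow_pow)
    then show ?thesis
      using x by (metis int_pow_mult int_pow_closed l_one mult_div_mod_eq)
  qed
  have "range (\<lambda>j::int. x [^] j) \<subseteq> (\<lambda>j::int. x [^] j) ` {0..<int n}"
  proof (rule image_subsetI)
    fix j :: int
    show "x [^] j \<in> (\<lambda>j::int. x [^] j) ` {0..<int n}"
      unfolding image_iff by (rule bexI[of _ "j mod int n"]) (use eq[of j] n(1) in auto)
  qed
  then show ?thesis by (rule finite_subset) simp
qed

text \<open>Adjoining \<open>e\<close> to \<open>F\<close> yields only products of a power of
  \<open>e\<close> with an element of \<open>generate G F\<close>, because \<open>e\<close> commutes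
  with that subgroup.\<close>

lemma (in group) finite_generate_commuting_torsion:
  assumes "finite F" "F \<subseteq> carrier G"
    and "\<And>x y. x \<in> F \<Longrightarrow> y \<in> F \<Longrightarrow> x \<otimes> y = y \<otimes> x"
    and "\<And>x. x \<in> F \<Longrightarrow> \<exists>n>(0::nat). x [^] n = \<one>"
  shows "finite (generate G F)"
  using assms
proof (induction F rule: finite_induct)
  case empty
  then show ?case by (simp add: generate_empty)
next
  case (insert e F)
  have eF: "e \<in> carrier G" "F \<subseteq> carrier G" using insert.prems by auto
  interpret F: subgroup "generate G F" G using generate_is_subgroup[OF eF(2)] .
  have fin: "finite (generate G F)" using insert by simp
  obtain n where n: "n > (0::nat)" "e [^] n = \<one>" using insert.prems(3) by blast
  have comm: "e \<otimes> z = z \<otimes> e" if "z \<in> generate G F" for z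
    using that
  proof (induction z rule: generate.induct)
    case (incl h) then show ?case using insert.prems(2) by simp
  next
    case (inv h)
    then have "e \<otimes> h = h \<otimes> e" "h \<in> carrier G" using insert.prems by auto
    then show ?case using eF by (metis inv_closed inv_equality inv_solve_left' m_assoc m_closed r_inv r_one)
  next
    case (eng h1 h2)
    then have "h1 \<in> carrier G" "h2 \<in> carrier G" by auto
    with eng show ?case using eF by (metis m_assoc)
  qed (use eF in simp)
  let ?X = "(\<lambda>(u, z). u \<otimes> z) ` (range (\<lambda>j::int. e [^] j) \<times> generate G F)"
  have eq: "e [^] j \<otimes> z \<otimes> e [^] k = e [^] (j + k) \<otimes> z"
    if "z \<in> generate G F" "k = 1 \<or> k = -1" for j k :: int and z
  proof -
    have "z \<otimes> e [^] k = e [^] k \<otimes> z"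
    proof (cases "k = 1")
      case True then show ?thesis using comm[OF that(1)] eF by (simp add: int_pow_1)
    next
      case False
      then have "e [^] k = inv e" using that eF by (simp add: int_pow_neg int_pow_1)
      moreover have "z \<otimes> inv e = inv e \<otimes> z"
        using comm[OF that(1)] eF that(1)
        by (metis F.mem_carrier inv_closed inv_solve_left inv_solve_right m_assoc m_closed)
      ultimately show ?thesis by simp
    qed
    then show ?thesis using eF that(1) by (simp add: m_assoc int_pow_mult)
  qed
  have "generate G (insert e F) \<subseteq> ?X"
  proof (rule generate_subset_if_right_closed)
    show "\<one> \<in> ?X"
      using eF by (auto intro!: image_eqI[of _ _ "(\<one>, \<one>)"] range_eqI[of _ _ "0::int"])
    fix x s assume x: "x \<in> ?X" and s: "s \<in> insert e F"
    then obtain j :: int and z where x_eq: "x = e [^] j \<otimes> z" and z: "z \<in> generate G F" by auto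
    have in_X: "e [^] i \<otimes> z' \<in> ?X" if "z' \<in> generate G F" for i :: int and z'
      using that by auto
    show "x \<otimes> s \<in> ?X"
    proof (cases "s = e")
      case True
      then show ?thesis using eq[OF z, of 1 j] in_X z x_eq eF by (simp add: int_pow_1)
    next
      case False
      then have "s \<in> generate G F" using s by (simp add: generate.incl)
      then show ?thesis using x_eq z in_X[of "z \<otimes> s"] eF by (simp add: m_assoc)
    qed
    show "x \<otimes> inv s \<in> ?X"
    proof (cases "s = e")
      case True
      then show ?thesis using eq[OF z, of "-1" j] in_X[of z "j - 1"] z x_eq eF
        by (simp add: int_pow_1 int_pow_neg)
    next
      case False
      then have "inv s \<in> generate G F" using s by (simp add: generate.inv)
      then show ?thesis using x_eq z in_X[of "z \<otimes> inv s"] eF by (simp add: m_assoc)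
    qed
  qed (use eF in auto)
  moreover have "finite ?X"
    using fin finite_range_torsion[OF eF(1) n] by blast
  ultimately show ?case by (rule finite_subset)
qed

section \<open>Cosets and finite index\<close>

lemma (in group) rcoset_eq_iff:
  assumes N: "subgroup N G" and g: "g \<in> carrier G" and h: "h \<in> carrier G"
  shows "N #> g = N #> h \<longleftrightarrow> g \<otimes> inv h \<in> N"
proof -
  have "g \<otimes> inv h \<in> N \<longleftrightarrow> g \<in> N #> h"
    using subgroup.rcos_module[OF N is_group h g] by simp
  then show ?thesis
    using rcos_self[OF g N] repr_independence[OF _ h N, of g] by auto
qed

text \<open>\<open>\<phi>\<close> is a mere map; its fibres lie in single cosets of
  \<open>N\<close>, so the index is at most the size of its image.\<close>

lemma (in group) finite_FactGroupI:
  assumes N: "subgroup N G" and fin: "finite (\<phi> ` carrier G)"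
    and eq: "\<And>g h. g \<in> carrier G \<Longrightarrow> h \<in> carrier G \<Longrightarrow> \<phi> g = \<phi> h \<Longrightarrow> g \<otimes> inv h \<in> N"
  shows "finite (carrier (G Mod N))"
proof -
  interpret N: subgroup N G by fact
  define s where "s y = (SOME g. g \<in> carrier G \<and> \<phi> g = y)" for y
  have s: "s (\<phi> g) \<in> carrier G \<and> \<phi> (s (\<phi> g)) = \<phi> g" if "g \<in> carrier G" for g
    unfolding s_def by (rule someI[of _ g]) (use that in auto)
  have "N #> g = N #> s (\<phi> g)" if g: "g \<in> carrier G" for g
    using rcoset_eq_iff[OF N g, of "s (\<phi> g)"] eq[OF g, of "s (\<phi> g)"] s[OF g] by simp
  then have "carrier (G Mod N) \<subseteq> (\<lambda>y. N #> s y) ` \<phi> ` carrier G"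
    by (auto simp: FactGroup_def RCOSETS_def)
  then show ?thesis using fin finite_surj by blast
qed

lemma (in group) finite_FactGroup_mono:
  assumes "subgroup M G" "subgroup N G" "M \<subseteq> N" "finite (carrier (G Mod M))"
  shows "finite (carrier (G Mod N))"
proof (rule finite_FactGroupI[OF assms(2), of "\<lambda>g. M #> g"])
  show "finite ((#>) M ` carrier G)"
    by (rule finite_subset[OF _ assms(4)]) (auto simp: FactGroup_def RCOSETS_def)
qed (use rcoset_eq_iff[OF assms(1)] assms(3) in blast)

lemma (in normal) group_hom_FactGroup: "group_hom G (G Mod H) (\<lambda>g. H #> g)"
  using r_coset_hom_Mod factorgroup_is_group by (intro group_hom.intro group_hom_axioms.intro is_group)

lemma (in normal) carrier_FactGroup_eq: "carrier (G Mod H) = (\<lambda>g. H #> g) ` carrier G"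
  by (auto simp: FactGroup_def RCOSETS_def)

lemma (in normal) generate_FactGroup:
  assumes "S \<subseteq> carrier G" "carrier G = generate G S"
  shows "carrier (G Mod H) = generate (G Mod H) ((\<lambda>g. H #> g) ` S)"
  using group_hom.generate_img[OF group_hom_FactGroup assms(1)] assms(2) carrier_FactGroup_eq
  by simp

text \<open>The commutators \<open>z \<beta>\<close> are central, so \<open>z\<close> is
  multiplicative on \<open>B\<close> and a product of such commutators is a single one. Hence the
  normal forms \<open>z \<gamma> \<otimes> \<beta> \<otimes> \<alpha> [^] i\<close> are finitely
  many and stay closed under right multiplication by the generators.\<close>

lemma (in group) finite_if_central_commutators:
  assumes \<alpha>: "\<alpha> \<in> carrier G" "n > (0::nat)" "\<alpha> [^] n = \<one>"
    and B: "subgroup B G" "finite B" "\<And>x y. x \<in> B \<Longrightarrow> y \<in> B \<Longrightarrow> x \<otimes> y = y \<otimes> x"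
    and central: "\<And>\<beta> g. \<beta> \<in> B \<Longrightarrow> g \<in> carrier G \<Longrightarrow>
      (\<alpha> \<otimes> \<beta> \<otimes> inv \<alpha> \<otimes> inv \<beta>) \<otimes> g = g \<otimes> (\<alpha> \<otimes> \<beta> \<otimes> inv \<alpha> \<otimes> inv \<beta>)"
    and gen: "carrier G = generate G (insert \<alpha> B)"
  shows "finite (carrier G)"
proof -
  interpret B: subgroup B G by fact
  define z where "z \<beta> = \<alpha> \<otimes> \<beta> \<otimes> inv \<alpha> \<otimes> inv \<beta>" for \<beta>
  have zc [simp]: "z \<beta> \<in> carrier G" if "\<beta> \<in> B" for \<beta>
    using that \<alpha> by (simp add: z_def)
  have zcomm: "z \<beta> \<otimes> g = g \<otimes> z \<beta>" if "\<beta> \<in> B" "g \<in> carrier G" for \<beta> g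
    using central that by (simp add: z_def)
  have zlcomm: "g \<otimes> (z \<beta> \<otimes> h) = z \<beta> \<otimes> (g \<otimes> h)"
    if "\<beta> \<in> B" "g \<in> carrier G" "h \<in> carrier G" for \<beta> g h
    using zcomm[OF that(1,2)] that by (metis m_assoc zc)
  have z: "\<alpha> \<otimes> \<beta> = z \<beta> \<otimes> \<beta> \<otimes> \<alpha>" if "\<beta> \<in> B" for \<beta>
    using that \<alpha> by (simp add: z_def m_assoc)
  have z_mult: "z (\<beta> \<otimes> \<gamma>) = z \<beta> \<otimes> z \<gamma>" if "\<beta> \<in> B" "\<gamma> \<in> B" for \<beta> \<gamma>
  proof -
    have "z (\<beta> \<otimes> \<gamma>) \<otimes> (\<beta> \<otimes> \<gamma> \<otimes> \<alpha>) = \<alpha> \<otimes> \<beta> \<otimes> \<gamma>"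
      using z[of "\<beta> \<otimes> \<gamma>"] that \<alpha> by (simp add: m_assoc)
    also have "\<dots> = z \<beta> \<otimes> \<beta> \<otimes> (\<alpha> \<otimes> \<gamma>)"
      using z[of \<beta>] that \<alpha> by (simp add: m_assoc)
    also have "\<dots> = z \<beta> \<otimes> (\<beta> \<otimes> z \<gamma>) \<otimes> \<gamma> \<otimes> \<alpha>"
      using z[of \<gamma>] that \<alpha> by (simp add: m_assoc)
    also have "\<dots> = (z \<beta> \<otimes> z \<gamma>) \<otimes> (\<beta> \<otimes> \<gamma> \<otimes> \<alpha>)"
      using zlcomm[of \<gamma> \<beta>] that \<alpha> by (simp add: m_assoc)
    finally show ?thesis using that \<alpha> by simp
  qed
  \<comment> \<open>Moving \<beta> past i factors \<alpha> collects i copies of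
    \<open>z \<beta>\<close>; the witness built by the induction is the i-th power of
    \<beta>.\<close>
  have pow: "\<exists>\<gamma>\<in>B. \<alpha> [^] i \<otimes> \<beta> = z \<gamma> \<otimes> \<beta> \<otimes> \<alpha> [^] i" if "\<beta> \<in> B" for i :: nat and \<beta>
  proof (induction i)
    case 0
    have "z \<one> = \<one>" using \<alpha> by (simp add: z_def)
    then show ?case using that by (intro bexI[of _ \<one>]) auto
  next
    case (Suc i)
    then obtain \<gamma> where \<gamma>: "\<gamma> \<in> B" "\<alpha> [^] i \<otimes> \<beta> = z \<gamma> \<otimes> \<beta> \<otimes> \<alpha> [^] i" by blast
    have "\<alpha> [^] Suc i \<otimes> \<beta> = \<alpha> [^] i \<otimes> (\<alpha> \<otimes> \<beta>)"
      using that \<alpha> by (simp add: m_assoc)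
    also have "\<dots> = (\<alpha> [^] i \<otimes> z \<beta>) \<otimes> (\<beta> \<otimes> \<alpha>)"
      using z[OF that] that \<alpha> by (simp add: m_assoc)
    also have "\<dots> = z \<beta> \<otimes> (\<alpha> [^] i \<otimes> \<beta>) \<otimes> \<alpha>"
      using zlcomm[OF that, of "\<alpha> [^] i"] that \<alpha> by (simp add: m_assoc)
    also have "\<dots> = z (\<beta> \<otimes> \<gamma>) \<otimes> \<beta> \<otimes> \<alpha> [^] Suc i"
      using \<gamma> z_mult[OF that \<gamma>(1)] that \<alpha> by (simp add: m_assoc)
    finally show ?case using \<gamma>(1) that by (intro bexI[of _ "\<beta> \<otimes> \<gamma>"]) auto
  qed
  define X where "X = (\<lambda>(\<gamma>, \<beta>, u). z \<gamma> \<otimes> \<beta> \<otimes> u) ` (B \<times> B \<times> range (\<lambda>i::nat. \<alpha> [^] i))"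
  have XI: "z \<gamma> \<otimes> \<beta> \<otimes> \<alpha> [^] i \<in> X" if "\<gamma> \<in> B" "\<beta> \<in> B" for \<gamma> \<beta> and i :: nat
    unfolding X_def using that by (auto intro!: image_eqI[of _ _ "(\<gamma>, \<beta>, \<alpha> [^] i)"])
  have X_B: "x \<otimes> \<beta>' \<in> X" if "x \<in> X" "\<beta>' \<in> B" for x \<beta>'
  proof -
    from that obtain \<gamma> \<beta> and i :: nat
      where x: "x = z \<gamma> \<otimes> \<beta> \<otimes> \<alpha> [^] i" "\<gamma> \<in> B" "\<beta> \<in> B" by (auto simp: X_def)
    obtain \<gamma>' where \<gamma>': "\<gamma>' \<in> B" "\<alpha> [^] i \<otimes> \<beta>' = z \<gamma>' \<otimes> \<beta>' \<otimes> \<alpha> [^] i"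
      using pow \<open>\<beta>' \<in> B\<close> by blast
    have "x \<otimes> \<beta>' = z \<gamma> \<otimes> (\<beta> \<otimes> z \<gamma>') \<otimes> \<beta>' \<otimes> \<alpha> [^] i"
      using x \<gamma>' that \<alpha> by (simp add: m_assoc)
    also have "\<dots> = z (\<gamma> \<otimes> \<gamma>') \<otimes> (\<beta> \<otimes> \<beta>') \<otimes> \<alpha> [^] i"
      using zlcomm[of \<gamma>' \<beta>] z_mult[of \<gamma> \<gamma>'] x \<gamma>' that \<alpha> by (simp add: m_assoc)
    finally show ?thesis using XI[of "\<gamma> \<otimes> \<gamma>'" "\<beta> \<otimes> \<beta>'" i] x \<gamma>' that by simp
  qed
  have X_pow: "x \<otimes> \<alpha> [^] k \<in> X" if "x \<in> X" for x and k :: nat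
  proof -
    from that obtain \<gamma> \<beta> and i :: nat
      where x: "x = z \<gamma> \<otimes> \<beta> \<otimes> \<alpha> [^] i" "\<gamma> \<in> B" "\<beta> \<in> B" by (auto simp: X_def)
    then have "x \<otimes> \<alpha> [^] k = z \<gamma> \<otimes> \<beta> \<otimes> \<alpha> [^] (i + k)"
      using \<alpha> by (simp add: m_assoc nat_pow_mult)
    then show ?thesis using XI x by simp
  qed
  \<comment> \<open>Torsion turns the inverse into a natural power, so the natural exponents in
    \<open>X\<close> suffice.\<close>
  have inv_\<alpha>: "inv \<alpha> = \<alpha> [^] (n - 1)"
  proof (rule inv_equality)
    show "\<alpha> [^] (n - 1) \<otimes> \<alpha> = \<one>"
      using \<alpha> by (metis One_nat_def Suc_pred nat_pow_Suc)
  qed (use \<alpha> in auto)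
  have "generate G (insert \<alpha> B) \<subseteq> X"
  proof (rule generate_subset_if_right_closed)
    show "X \<subseteq> carrier G" using \<alpha> by (auto simp: X_def)
    have "z \<one> = \<one>" using \<alpha> by (simp add: z_def)
    then show "\<one> \<in> X" using XI[of \<one> \<one> 0] by simp
    fix x s assume "x \<in> X" "s \<in> insert \<alpha> B"
    then show "x \<otimes> s \<in> X" "x \<otimes> inv s \<in> X"
      using X_B X_pow[of x 1] X_pow[of x "n - 1"] inv_\<alpha> \<alpha>(1) by auto
  qed (use \<alpha> in auto)
  moreover have "finite X"
  proof -
    have "range (\<lambda>i::nat. \<alpha> [^] i) \<subseteq> range (\<lambda>j::int. \<alpha> [^] j)"
      by (metis image_subset_iff int_pow_int rangeI)
    then have "finite (range (\<lambda>i::nat. \<alpha> [^] i))"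
      using finite_range_torsion[OF \<alpha>] finite_subset by blast
    then show ?thesis unfolding X_def using B(2) by blast
  qed
  ultimately show ?thesis using gen finite_subset by auto
qed

text \<open>The dihedral normal form over a central subgroup. For the rotation t = \<alpha>\<beta>
  one has \<beta> = t^-1 \<alpha>, so right multiplication by \<beta> either lowers the exponent and
  introduces \<alpha>, or raises it and absorbs \<alpha>.\<close>

lemma (in group) generate_involutions_normal_form:
  assumes \<alpha>: "\<alpha> \<in> carrier G" "\<alpha> \<otimes> \<alpha> = \<one>" and \<beta>: "\<beta> \<in> carrier G" "\<beta> \<otimes> \<beta> = \<one>"
    and Z: "subgroup Z G" "\<forall>z\<in>Z. \<forall>g\<in>carrier G. z \<otimes> g = g \<otimes> z"
    and g: "g \<in> generate G (insert \<alpha> (insert \<beta> Z))"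
  obtains z x and j :: int
    where "g = z \<otimes> (\<alpha> \<otimes> \<beta>) [^] j \<otimes> x" "z \<in> Z" "x \<in> {\<one>, \<alpha>}"
proof -
  let ?X = "{z \<otimes> (\<alpha> \<otimes> \<beta>) [^] (j::int) \<otimes> x | z j x. z \<in> Z \<and> x \<in> {\<one>, \<alpha>}}"
  interpret Z: subgroup Z G by fact
  define t where "t = \<alpha> \<otimes> \<beta>"
  have t [simp]: "t \<in> carrier G" using \<alpha> \<beta> by (simp add: t_def)
  have XI: "z \<otimes> t [^] j \<otimes> x \<in> ?X" if "z \<in> Z" "x \<in> {\<one>, \<alpha>}" for z x and j :: int
    using that by (auto simp: t_def)
  have \<alpha>inv: "inv \<alpha> = \<alpha>" "inv \<beta> = \<beta>" using \<alpha> \<beta> inv_equality by auto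
  then have inv_t: "inv t = \<beta> \<otimes> \<alpha>" unfolding t_def using \<alpha> \<beta> by (simp add: inv_mult_group)
  have closed: "x \<otimes> s \<in> ?X" if x_in: "x \<in> ?X" and s_in: "s \<in> insert \<alpha> (insert \<beta> Z)" for x s
  proof -
    from x_in obtain z y and j :: int
      where x: "x = z \<otimes> t [^] j \<otimes> y" "z \<in> Z" "y \<in> {\<one>, \<alpha>}" by (auto simp: t_def)
    have y: "y \<in> carrier G" using x \<alpha> by auto
    consider "s = \<alpha>" | "s = \<beta>" | "s \<in> Z" using s_in by blast
    then show ?thesis
    proof cases
      case 1
      then have "x \<otimes> s = z \<otimes> t [^] j \<otimes> (if y = \<one> then \<alpha> else \<one>)"
        using x y \<alpha> by (auto simp: m_assoc)
      then show ?thesis using XI[OF x(2)] by simp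
    next
      case 2
      show ?thesis
      proof (cases "y = \<one>")
        case True
        have "\<beta> = inv t \<otimes> \<alpha>" using \<alpha> \<beta> inv_t by (simp add: m_assoc)
        then have "x \<otimes> s = z \<otimes> (t [^] j \<otimes> inv t) \<otimes> \<alpha>" using x 2 True \<alpha> by (simp add: m_assoc)
        also have "t [^] j \<otimes> inv t = t [^] (j - 1)" by (simp add: int_pow_diff)
        finally show ?thesis using XI[OF x(2)] by simp
      next
        case False
        then have "x \<otimes> s = z \<otimes> (t [^] j \<otimes> t)"
          using x 2 \<alpha> \<beta> by (auto simp: m_assoc t_def)
        also have "t [^] j \<otimes> t = t [^] (j + 1)" by (simp add: int_pow_mult)
        finally show ?thesis using XI[OF x(2), of \<one> "j + 1"] x(2) by simp
      qed
    next
      case 3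
      have "x \<in> carrier G" using x y by simp
      with 3 Z(2) have "x \<otimes> s = s \<otimes> x" by metis
      also have "\<dots> = (s \<otimes> z) \<otimes> t [^] j \<otimes> y" using x y 3 by (simp add: m_assoc)
      finally show ?thesis using XI[of "s \<otimes> z" y j] 3 x by simp
    qed
  qed
  have "generate G (insert \<alpha> (insert \<beta> Z)) \<subseteq> ?X"
  proof (rule generate_subset_if_right_closed[OF _ _ _ closed])
    show "\<one> \<in> ?X" using XI[of \<one> \<one> 0] by simp
    fix x s assume "x \<in> ?X" "s \<in> insert \<alpha> (insert \<beta> Z)"
    then show "x \<otimes> inv s \<in> ?X" using closed[of x "inv s"] \<alpha>inv by auto
  qed (use \<alpha> \<beta> in auto)
  with g that show ?thesis by blast
qed

lemma (in group) finite_if_involutions: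
  assumes \<alpha>: "\<alpha> \<in> carrier G" "\<alpha> \<otimes> \<alpha> = \<one>" and \<beta>: "\<beta> \<in> carrier G" "\<beta> \<otimes> \<beta> = \<one>"
    and n: "n > (0::nat)" "(\<alpha> \<otimes> \<beta>) [^] n = \<one>"
    and Z: "subgroup Z G" "finite Z" "\<forall>z\<in>Z. \<forall>g\<in>carrier G. z \<otimes> g = g \<otimes> z"
    and gen: "carrier G = generate G (insert \<alpha> (insert \<beta> Z))"
  shows "finite (carrier G)"
proof -
  have "carrier G \<subseteq> (\<lambda>(z, u, x). z \<otimes> u \<otimes> x) `
      (Z \<times> range (\<lambda>j::int. (\<alpha> \<otimes> \<beta>) [^] j) \<times> {\<one>, \<alpha>})"
  proof
    fix g assume "g \<in> carrier G"
    then have "g \<in> generate G (insert \<alpha> (insert \<beta> Z))" by (subst (asm) gen)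
    then obtain z x and j :: int
      where "g = z \<otimes> (\<alpha> \<otimes> \<beta>) [^] j \<otimes> x" "z \<in> Z" "x \<in> {\<one>, \<alpha>}"
      using generate_involutions_normal_form[OF \<alpha> \<beta> Z(1,3)] by blast
    then show "g \<in> (\<lambda>(z, u, x). z \<otimes> u \<otimes> x) `
      (Z \<times> range (\<lambda>j::int. (\<alpha> \<otimes> \<beta>) [^] j) \<times> {\<one>, \<alpha>})"
      by (intro image_eqI[of _ _ "(z, (\<alpha> \<otimes> \<beta>) [^] j, x)"]) auto
  qed
  moreover have "finite (range (\<lambda>j::int. (\<alpha> \<otimes> \<beta>) [^] j))"
    using finite_range_torsion[OF _ n] \<alpha> \<beta> by simp
  ultimately show ?thesis using Z(2) finite_subset by fastforce
qed

text \<open>A reflection in \<open>N\<close> forces the square of the rotation \<open>\<alpha> \<otimes> \<beta>\<close> into \<open>N\<close>, so that in any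
  case \<open>N\<close> contains a nontrivial power of the rotation.\<close>

lemma (in group) finite_FactGroup_dihedral:
  assumes \<alpha>: "\<alpha> \<in> carrier G" "\<alpha> \<otimes> \<alpha> = \<one>" and \<beta>: "\<beta> \<in> carrier G" "\<beta> \<otimes> \<beta> = \<one>"
    and gen: "carrier G = generate G {\<alpha>, \<beta>}"
    and N: "N \<lhd> G" "N \<noteq> {\<one>}"
  shows "finite (carrier (G Mod N))"
proof -
  interpret N: normal N G by fact
  define t where "t = \<alpha> \<otimes> \<beta>"
  have t [simp]: "t \<in> carrier G" using \<alpha> \<beta> by (simp add: t_def)
  have gen': "carrier G = generate G (insert \<alpha> (insert \<beta> {\<one>}))"
    using gen mono_generate[of "{\<alpha>, \<beta>}" "insert \<alpha> (insert \<beta> {\<one>})"]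
      generate_incl[of "insert \<alpha> (insert \<beta> {\<one>})"] \<alpha> \<beta> by auto
  obtain g where g: "g \<in> N" "g \<noteq> \<one>" using N(2) N.one_closed by blast
  have "\<forall>z\<in>{\<one>}. \<forall>g\<in>carrier G. z \<otimes> g = g \<otimes> z" by simp
  note nf = generate_involutions_normal_form[OF \<alpha> \<beta> triv_subgroup this]
  have "g \<in> carrier G" using g by simp
  then have "g \<in> generate G (insert \<alpha> (insert \<beta> {\<one>}))" by (subst (asm) gen')
  from nf[OF this] obtain z x and j :: int
    where gx': "g = z \<otimes> t [^] j \<otimes> x" "z \<in> {\<one>}" "x \<in> {\<one>, \<alpha>}"
    unfolding t_def by blast
  have "x \<in> carrier G" using gx'(3) \<alpha> by auto
  then have gx: "g = t [^] j \<otimes> x" "x \<in> {\<one>, \<alpha>}" using gx' by simp_all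
  have "\<exists>k>(0::nat). t [^] k \<in> N"
  proof (cases "x = \<one>")
    case True
    then have g_eq: "g = t [^] j" using gx by simp
    with g have "j \<noteq> 0" by auto
    moreover have "t [^] (nat \<bar>j\<bar>) \<in> N"
    proof (cases "j \<ge> 0")
      case True
      then show ?thesis using g g_eq by (metis abs_of_nonneg int_pow_int nat_0_le)
    next
      case False
      then have "t [^] (nat \<bar>j\<bar>) = inv (t [^] j)"
        by (metis abs_of_neg int_pow_int int_pow_neg linorder_not_le nat_0_le neg_0_le_iff_le order_less_imp_le t)
      then show ?thesis using g g_eq by simp
    qed
    ultimately show ?thesis by (intro exI[of _ "nat \<bar>j\<bar>"]) auto
  next
    case False
    then have x: "x = \<alpha>" using gx by simp
    have "inv \<alpha> = \<alpha>" "inv \<beta> = \<beta>" using \<alpha> \<beta> inv_equality by auto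
    then have inv_t: "inv t = \<beta> \<otimes> \<alpha>" unfolding t_def using \<alpha> \<beta> by (simp add: inv_mult_group)
    \<comment> \<open>The reflection \<alpha> inverts the rotation, so conjugation by
      \<open>t\<close> multiplies the reflection \<open>g\<close> by the square of
      \<open>t\<close>.\<close>
    have "\<alpha> \<otimes> inv t = t \<otimes> \<alpha>"
      unfolding inv_t using \<alpha> \<beta> by (simp add: t_def m_assoc)
    then have "t \<otimes> g \<otimes> inv t = t \<otimes> t [^] j \<otimes> t \<otimes> \<alpha>"
      using gx x \<alpha> by (simp add: m_assoc)
    also have "t \<otimes> t [^] j \<otimes> t = t [^] (2::int) \<otimes> t [^] j"
    proof -
      have "t \<otimes> t [^] j \<otimes> t = t [^] (1::int) \<otimes> t [^] j \<otimes> t [^] (1::int)" by simp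
      also have "\<dots> = t [^] (1 + j + 1)" by (simp only: int_pow_mult t m_closed int_pow_closed)
      also have "1 + j + 1 = 2 + j" by simp
      finally show ?thesis by (simp only: int_pow_mult t)
    qed
    finally have "t \<otimes> g \<otimes> inv t = t [^] (2::int) \<otimes> g"
      using gx x \<alpha> by (simp add: m_assoc)
    moreover have "t \<otimes> g \<otimes> inv t \<in> N" using g N.inv_op_closed2 by simp
    ultimately have "t [^] (2::int) \<otimes> g \<otimes> inv g \<in> N" using g by (metis N.m_closed N.m_inv_closed)
    then have "t [^] (2::int) \<in> N" using g by (simp add: m_assoc)
    then have "t [^] (2::nat) \<in> N" by (metis int_pow_int of_nat_numeral)
    then show ?thesis by (intro exI[of _ 2]) auto
  qed
  then obtain k where k: "k > (0::nat)" "t [^] k \<in> N" by blast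
  interpret Q: group "G Mod N" by (rule N.factorgroup_is_group)
  interpret \<pi>: group_hom G "G Mod N" "\<lambda>g. N #> g" by (rule N.group_hom_FactGroup)
  have one: "N #> g = \<one>\<^bsub>G Mod N\<^esub>" if "g \<in> N" for g
    using that by (simp add: FactGroup_def coset_join2 N.subgroup_axioms)
  have central: "\<forall>z\<in>{\<one>\<^bsub>G Mod N\<^esub>}. \<forall>y\<in>carrier (G Mod N). z \<otimes>\<^bsub>G Mod N\<^esub> y = y \<otimes>\<^bsub>G Mod N\<^esub> z"
    using Q.l_one Q.r_one by (metis singletonD)
  show ?thesis
  proof (rule Q.finite_if_involutions[where Z = "{\<one>\<^bsub>G Mod N\<^esub>}"])
    show "N #> \<alpha> \<in> carrier (G Mod N)" "N #> \<beta> \<in> carrier (G Mod N)" using \<alpha> \<beta> by auto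
    show "(N #> \<alpha>) \<otimes>\<^bsub>G Mod N\<^esub> (N #> \<alpha>) = \<one>\<^bsub>G Mod N\<^esub>" "(N #> \<beta>) \<otimes>\<^bsub>G Mod N\<^esub> (N #> \<beta>) = \<one>\<^bsub>G Mod N\<^esub>"
      using \<alpha> \<beta> by (metis \<pi>.hom_mult \<pi>.hom_one)+
    show "((N #> \<alpha>) \<otimes>\<^bsub>G Mod N\<^esub> (N #> \<beta>)) [^]\<^bsub>G Mod N\<^esub> k = \<one>\<^bsub>G Mod N\<^esub>"
      using one[OF k(2)] \<alpha> \<beta> t by (metis \<pi>.hom_mult \<pi>.hom_nat_pow t_def)
    show "carrier (G Mod N) = generate (G Mod N) (insert (N #> \<alpha>) (insert (N #> \<beta>) {\<one>\<^bsub>G Mod N\<^esub>}))"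
      using N.generate_FactGroup[OF _ gen'] \<alpha> \<beta> \<pi>.hom_one by simp
  qed (rule central Q.triv_subgroup k(1) finite.emptyI finite.insertI)+
qed

text \<open>Modulo \<open>derived G K\<close> the elements of \<open>K\<close> commute, so a
  conjugate of \<open>e\<close> depends only on the coset modulo \<open>K\<close> of the conjugating
  element. The image of \<open>K\<close> is therefore abelian and generated by finitely many torsion
  elements, hence finite, and the quotient is an extension of \<open>G Mod K\<close> by it.\<close>

lemma (in group) finite_FactGroup_derived:
  assumes K: "K \<lhd> G" "finite (carrier (G Mod K))"
    and gen: "K = generate G (\<Union>g\<in>carrier G. (\<lambda>e. g \<otimes> e \<otimes> inv g) ` E)"
    and E: "finite E" "E \<subseteq> carrier G" "\<And>e. e \<in> E \<Longrightarrow> \<exists>n>(0::nat). e [^] n = \<one>"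
  shows "finite (carrier (G Mod (derived G K)))"
proof -
  interpret K: normal K G by fact
  define D where "D = derived G K"
  interpret D: normal D G unfolding D_def by (rule derived_is_normal[OF K(1)])
  interpret Q: group "G Mod D" by (rule D.factorgroup_is_group)
  interpret \<pi>: group_hom G "G Mod D" "\<lambda>g. D #> g" by (rule D.group_hom_FactGroup)
  have comm_D: "h \<otimes> k \<otimes> inv h \<otimes> inv k \<in> D" if "h \<in> K" "k \<in> K" for h k
    unfolding D_def derived_def using that by (intro generate.incl) auto
  define S where "S = (\<Union>g\<in>carrier G. (\<lambda>e. g \<otimes> e \<otimes> inv g) ` E)"
  have S: "S \<subseteq> carrier G" using E(2) by (auto simp: S_def)
  have SK: "S \<subseteq> K" using gen generate.incl[of _ S G] by (auto simp: S_def)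
  have EK: "E \<subseteq> K"
  proof
    fix e assume "e \<in> E"
    then have "\<one> \<otimes> e \<otimes> inv \<one> \<in> S" "e \<in> carrier G" using E(2) unfolding S_def by blast+
    then show "e \<in> K" using SK by auto
  qed
  define F where "F = (\<lambda>g. D #> g) ` S"
  define r where "r c = (SOME g. g \<in> carrier G \<and> K #> g = c)" for c
  have r: "r (K #> g) \<in> carrier G" "K #> r (K #> g) = K #> g" if "g \<in> carrier G" for g
    using someI[of "\<lambda>h. h \<in> carrier G \<and> K #> h = K #> g" g] that unfolding r_def by auto
  have fin_F: "finite F"
  proof -
    have "F \<subseteq> (\<lambda>(c, e). D #> (r c \<otimes> e \<otimes> inv r c)) ` (carrier (G Mod K) \<times> E)"
    proof
      fix y assume "y \<in> F"
      then obtain g e where g: "g \<in> carrier G" "e \<in> E" "y = D #> (g \<otimes> e \<otimes> inv g)"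
        by (auto simp: F_def S_def)
      define h where "h = r (K #> g)"
      define k where "k = g \<otimes> inv h"
      have h: "h \<in> carrier G" and k: "k \<in> K"
        using r[OF g(1)] rcoset_eq_iff[OF K.subgroup_axioms g(1), of h]
        by (simp_all add: h_def k_def)
      have e: "e \<in> carrier G" "e \<in> K" using g E EK by auto
      have u: "h \<otimes> e \<otimes> inv h \<in> K" using K.inv_op_closed2[OF h e(2)] .
      \<comment> \<open>The conjugates of \<open>e\<close> by \<open>g\<close> and by
        \<open>h\<close> differ by the commutator of \<open>k\<close> with the latter, and both of
        these lie in \<open>K\<close>.\<close>
      have "g = k \<otimes> h" using g h by (simp add: k_def m_assoc)
      then have "(g \<otimes> e \<otimes> inv g) \<otimes> inv (h \<otimes> e \<otimes> inv h)
          = k \<otimes> (h \<otimes> e \<otimes> inv h) \<otimes> inv k \<otimes> inv (h \<otimes> e \<otimes> inv h)"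
        using g h k e by (simp add: m_assoc inv_mult_group)
      also have "\<dots> \<in> D" using comm_D[OF k u] .
      finally have "y = D #> (h \<otimes> e \<otimes> inv h)"
        unfolding g(3) using g(1) h e(1) by (intro iffD2[OF rcoset_eq_iff[OF D.subgroup_axioms]]) auto
      then show "y \<in> (\<lambda>(c, e). D #> (r c \<otimes> e \<otimes> inv r c)) ` (carrier (G Mod K) \<times> E)"
        using g K.carrier_FactGroup_eq h_def by (intro image_eqI[of _ _ "(K #> g, e)"]) auto
    qed
    then show ?thesis using K(2) E(1) finite_subset by fastforce
  qed
  have "finite (generate (G Mod D) F)"
  proof (rule Q.finite_generate_commuting_torsion[OF fin_F])
    show "F \<subseteq> carrier (G Mod D)" using S D.carrier_FactGroup_eq F_def by auto
    show "x \<otimes>\<^bsub>G Mod D\<^esub> y = y \<otimes>\<^bsub>G Mod D\<^esub> x" if xy: "x \<in> F" "y \<in> F" for x y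
    proof -
      obtain g h where gh: "g \<in> S" "h \<in> S" "x = D #> g" "y = D #> h" using xy F_def by blast
      then have c: "g \<in> carrier G" "h \<in> carrier G" "g \<in> K" "h \<in> K" using S SK by auto
      have "(g \<otimes> h) \<otimes> inv (h \<otimes> g) \<in> D"
        using comm_D[OF c(3,4)] c by (simp add: inv_mult_group m_assoc)
      then have "D #> (g \<otimes> h) = D #> (h \<otimes> g)"
        using c by (intro iffD2[OF rcoset_eq_iff[OF D.subgroup_axioms]]) auto
      then show ?thesis using gh c \<pi>.hom_mult by metis
    qed
    show "\<exists>n>(0::nat). x [^]\<^bsub>G Mod D\<^esub> n = \<one>\<^bsub>G Mod D\<^esub>" if x_F: "x \<in> F" for x
    proof -
      obtain g e where g: "g \<in> carrier G" "e \<in> E" "x = D #> (g \<otimes> e \<otimes> inv g)"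
        using x_F by (auto simp: F_def S_def)
      obtain n where n: "n > (0::nat)" "e [^] n = \<one>" using E(3) g by blast
      have e: "e \<in> carrier G" using g E by auto
      have "(g \<otimes> e \<otimes> inv g) [^] n = \<one>" using n g(1) nat_pow_conjugate[OF g(1) e] by simp
      then have "x [^]\<^bsub>G Mod D\<^esub> n = \<one>\<^bsub>G Mod D\<^esub>"
        using g e \<pi>.hom_nat_pow[of "g \<otimes> e \<otimes> inv g" n] \<pi>.hom_one by auto
      then show ?thesis using n by blast
    qed
  qed
  then have fin: "finite ((\<lambda>g. D #> g) ` K)"
    using \<pi>.generate_img[OF S] gen unfolding F_def S_def by simp
  have "carrier (G Mod D) \<subseteq> (\<lambda>(u, c). u \<otimes>\<^bsub>G Mod D\<^esub> (D #> r c)) ` ((\<lambda>g. D #> g) ` K \<times> carrier (G Mod K))"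
  proof
    fix y assume "y \<in> carrier (G Mod D)"
    then obtain g where g: "g \<in> carrier G" "y = D #> g" using D.carrier_FactGroup_eq by auto
    define h where "h = r (K #> g)"
    have h: "h \<in> carrier G" and k: "g \<otimes> inv h \<in> K"
      using r[OF g(1)] rcoset_eq_iff[OF K.subgroup_axioms g(1), of h] by (simp_all add: h_def)
    have "D #> (g \<otimes> inv h \<otimes> h) = (D #> (g \<otimes> inv h)) \<otimes>\<^bsub>G Mod D\<^esub> (D #> h)"
      using g h by (intro \<pi>.hom_mult) auto
    then have "y = (D #> (g \<otimes> inv h)) \<otimes>\<^bsub>G Mod D\<^esub> (D #> h)"
      using g h by (simp add: m_assoc)
    then show "y \<in> (\<lambda>(u, c). u \<otimes>\<^bsub>G Mod D\<^esub> (D #> r c)) ` ((\<lambda>g. D #> g) ` K \<times> carrier (G Mod K))"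
      using k g K.carrier_FactGroup_eq unfolding h_def
      by (intro image_eqI[of _ _ "(D #> (g \<otimes> inv r (K #> g)), K #> g)"]) auto
  qed
  then show ?thesis using fin K(2) finite_subset unfolding D_def by fastforce
qed

section \<open>Automorphisms supported below a vertex\<close>

text \<open>The copy of \<open>g\<close> in the rigid stabilizer of the vertex
  \<open>u\<close>.\<close>

fun at_vertex :: "'x list \<Rightarrow> ('x list \<Rightarrow> 'x list) \<Rightarrow> 'x list \<Rightarrow> 'x list" where
  "at_vertex [] g w = g w"
| "at_vertex (x # u) g [] = []"
| "at_vertex (x # u) g (y # w) = (if y = x then y # at_vertex u g w else y # w)"

lemma at_vertex_append [simp]: "at_vertex u g (u @ w) = u @ g w"
  by (induction u) auto

lemma at_vertex_outside: "(\<And>v. w \<noteq> u @ v) \<Longrightarrow> at_vertex u g w = w"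
proof (induction u g w rule: at_vertex.induct)
  case (3 x u g y w) then show ?case by (cases "y = x") fastforce+
qed auto

lemma at_vertex_Cons: "at_vertex (x # u) g = at_vertex [x] (at_vertex u g)"
proof
  show "at_vertex (x # u) g w = at_vertex [x] (at_vertex u g) w" for w by (cases w) auto
qed

lemma at_vertex_comp: "at_vertex u (g \<circ> h) = at_vertex u g \<circ> at_vertex u h"
proof
  show "at_vertex u (g \<circ> h) w = (at_vertex u g \<circ> at_vertex u h) w" for w
    by (cases "\<exists>v. w = u @ v") (auto simp: at_vertex_outside)
qed

lemma at_vertex_id [simp]: "at_vertex u id = id"
proof
  show "at_vertex u id w = id w" for w
    by (cases "\<exists>v. w = u @ v") (auto simp: at_vertex_outside)
qed

text \<open>Distinct vertices of one level have disjoint subtrees, so the supports are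
  disjoint.\<close>

lemma at_vertex_commute:
  assumes "length u = length u'" "u \<noteq> u'"
  shows "at_vertex u g \<circ> at_vertex u' h = at_vertex u' h \<circ> at_vertex u g"
proof
  fix w
  have disj: "u @ v \<noteq> u' @ v'" for v v' using assms by simp
  consider v where "w = u @ v" | v where "w = u' @ v" | "\<nexists>v. w = u @ v" "\<nexists>v. w = u' @ v" by blast
  then show "(at_vertex u g \<circ> at_vertex u' h) w = (at_vertex u' h \<circ> at_vertex u g) w"
    using disj disj[symmetric] by cases (auto simp: at_vertex_outside)
qed

text \<open>\<open>\<gamma>\<close> carries the subtree below \<open>u\<close> onto the one below
  \<open>u'\<close> through \<open>h\<close>. Surjectivity of \<open>h\<close> and injectivity of
  \<open>\<gamma>\<close> keep every other word outside the latter subtree.\<close>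

lemma at_vertex_conjugate:
  assumes "inj \<gamma>" "surj h" "\<And>v. \<gamma> (u @ v) = u' @ h v" "g' \<circ> h = h \<circ> g"
  shows "\<gamma> \<circ> at_vertex u g = at_vertex u' g' \<circ> \<gamma>"
proof
  fix w
  show "(\<gamma> \<circ> at_vertex u g) w = (at_vertex u' g' \<circ> \<gamma>) w"
  proof (cases "\<exists>v. w = u @ v")
    case True
    then show ?thesis using assms(3) fun_cong[OF assms(4)] by auto
  next
    case False
    have "\<gamma> w \<noteq> u' @ v" for v
    proof
      assume eq: "\<gamma> w = u' @ v"
      obtain v' where "v = h v'" using assms(2) by (metis surj_def)
      then have "\<gamma> w = \<gamma> (u @ v')" using eq assms(3) by simp
      then show False using False assms(1) by (meson injD)
    qed
    then show ?thesis using False by (simp add: at_vertex_outside)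
  qed
qed

section \<open>The generators and the sections\<close>

lemma mod_ring_two_cases: "CARD('p::prime_card) = 2 \<Longrightarrow> (x :: 'p mod_ring) = 0 \<or> x = 1"
proof -
  assume "CARD('p) = 2"
  then obtain i where "i < 2" "x = of_nat i" using surj_of_nat_mod_ring[of x] by auto
  moreover from \<open>i < 2\<close> have "i = 0 \<or> i = 1" by auto
  ultimately show ?thesis by auto
qed

lemma mod_ring_one_eq_minus_one_iff: "(1 :: 'p::prime_card mod_ring) = - 1 \<longleftrightarrow> CARD('p) = 2"
proof
  assume "(1 :: 'p mod_ring) = - 1"
  then have "(1 :: 'p mod_ring) + 1 = 0" by (metis add.right_inverse)
  then have "of_nat 2 = (0 :: 'p mod_ring)" by simp
  then have "CARD('p) dvd 2" by (rule of_nat_0_mod_ring_dvd)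
  then show "CARD('p) = 2" using prime_card[where 'a = 'p] primes_dvd_imp_eq two_is_prime_nat by blast
next
  assume "CARD('p) = 2"
  then have "(1 :: 'p mod_ring) + 1 = 0" using of_nat_card_eq_0[where 'a = 'p] by simp
  then show "(1 :: 'p mod_ring) = - 1" by (simp add: eq_neg_iff_add_eq_0)
qed

lemma act_A_comp: "act_A k \<circ> act_A l = act_A (l + k)"
proof
  show "(act_A k \<circ> act_A l) w = act_A (l + k) w" for w by (cases w) auto
qed

lemma act_A_0: "act_A 0 = id"
proof
  show "act_A 0 w = id w" for w by (cases w) auto
qed

locale sunic =
  fixes f :: "'p::prime_card mod_ring poly"
  assumes deg: "degree f \<ge> 1"
    and coeff_0: "coeff f 0 \<noteq> 0"
begin

abbreviation "G \<equiv> sunic_group f"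
abbreviation "V \<equiv> carrier_vec (degree f) :: 'p mod_ring vec set"

sublocale G: group "sunic_group f" by (rule group_sunic_group)

section \<open>The linear maps \<rho> and \<omega>, and the action of \<open>B\<close>\<close>

lemma rho_carrier [simp]: "rho f c \<in> V"
  unfolding rho_def by (simp add: carrier_vecI)

lemma rho_add: "c \<in> V \<Longrightarrow> d \<in> V \<Longrightarrow> rho f (c + d) = rho f c + rho f d"
  unfolding rho_def
  by (rule mult_add_distrib_mat_vec[where nr = "degree f" and nc = "degree f"])
    (auto simp: mat_of_cols_def)

lemma omega_add: "c \<in> V \<Longrightarrow> d \<in> V \<Longrightarrow> omega f (c + d) = omega f c + omega f d"
  unfolding omega_def using deg by simp

text \<open>The last column of the matrix carries the negated coefficients; the other columns shift
  the coordinates up by one.\<close>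

lemma rho_index:
  assumes c: "c \<in> V" and j: "j < degree f"
  shows "rho f c $ j = (if j = 0 then 0 else c $ (j - 1)) - coeff f j * omega f c"
proof -
  let ?m = "degree f"
  define M where "M i = rho_basis f i $ j" for i
  have Suc: "{0..<?m} = insert (?m - 1) {0..<?m - 1}" using deg by auto
  have "rho f c $ j = (\<Sum>i\<in>{0..<?m}. M i * c $ i)"
    using c j unfolding rho_def M_def
    by (simp add: scalar_prod_def mat_of_cols_index)
  also have "\<dots> = M (?m - 1) * c $ (?m - 1) + (\<Sum>i\<in>{0..<?m - 1}. M i * c $ i)"
    unfolding Suc by (subst sum.insert) auto
  also have "M (?m - 1) = - coeff f j" using j deg by (simp add: M_def rho_basis_def Let_def)
  \<comment> \<open>For \<open>j = 0\<close> truncated subtraction makes \<open>j - 1\<close> the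
    genuine index 0; the inner conditional sets that term to zero.\<close>
  also have "(\<Sum>i\<in>{0..<?m - 1}. M i * c $ i) = (\<Sum>i\<in>{0..<?m - 1}. if i = j - 1 then (if j = 0 then 0 else c $ (j - 1)) else 0)"
    using j by (intro sum.cong) (auto simp: M_def rho_basis_def Let_def unit_vec_def)
  also have "\<dots> = (if j = 0 then 0 else c $ (j - 1))"
    using j by (auto simp: sum.delta)
  finally show ?thesis by (simp add: omega_def)
qed

text \<open>Coordinate 0 of \<rho>(c) is -a_0 \<omega>(c) with a_0 nonzero, which recovers
  \<omega>(c), the last coordinate. The higher coordinates of \<rho>(c) then give the
  others.\<close>

lemma inj_on_rho: "inj_on (rho f) V"
proof (rule inj_onI)
  fix c d assume c: "c \<in> V" and d: "d \<in> V" and eq: "rho f c = rho f d"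
  have om: "omega f c = omega f d"
    using rho_index[OF c, of 0] rho_index[OF d, of 0] eq deg coeff_0 by simp
  show "c = d"
  proof (rule eq_vecI)
    fix i assume "i < dim_vec d"
    then have i: "i < degree f" using d by simp
    show "c $ i = d $ i"
    proof (cases "Suc i < degree f")
      case True
      then show ?thesis using rho_index[OF c True] rho_index[OF d True] eq om by simp
    next
      case False
      then have "i = degree f - 1" using i by simp
      then show ?thesis using om by (simp add: omega_def)
    qed
  qed (use c d in simp)
qed

lemma finite_V: "finite V"
proof -
  have "V \<subseteq> vec_of_list ` {xs. set xs \<subseteq> UNIV \<and> length xs = degree f}"
  proof
    fix c assume "c \<in> V"
    then have "length (list_of_vec c) = degree f" by (simp add: Matrix.length_list_of_vec)
    then show "c \<in> vec_of_list ` {xs. set xs \<subseteq> UNIV \<and> length xs = degree f}"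
      by (metis (mono_tags, lifting) image_iff mem_Collect_eq subset_UNIV vec_list)
  qed
  moreover have "finite {xs :: 'p mod_ring list. set xs \<subseteq> UNIV \<and> length xs = degree f}"
    by (rule finite_lists_length_eq) simp
  ultimately show ?thesis by (rule finite_subset[OF _ finite_imageI])
qed

lemma rho_surj: "rho f ` V = V"
  using inj_on_rho finite_V by (intro endo_inj_surj) auto

lemma act_B_comp: "c \<in> V \<Longrightarrow> d \<in> V \<Longrightarrow> act_B f c \<circ> act_B f d = act_B f (c + d)"
proof
  fix w assume "c \<in> V" "d \<in> V"
  then show "(act_B f c \<circ> act_B f d) w = act_B f (c + d) w"
  proof (induction w arbitrary: c d)
    case (Cons x w)
    have "(act_B f (rho f c) \<circ> act_B f (rho f d)) w = act_B f (rho f c + rho f d) w"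
      using Cons.IH by simp
    then show ?case using Cons.prems fun_cong[OF act_A_comp, of "omega f c" "omega f d" w]
      by (auto simp: rho_add omega_add add.commute)
  qed simp
qed

text \<open>By \<open>act_B_comp\<close> the map is idempotent, and an injective idempotent map is
  the identity.\<close>

lemma act_B_0: "act_B f (0\<^sub>v (degree f)) = id"
proof -
  let ?z = "0\<^sub>v (degree f) :: 'p mod_ring vec"
  have "act_B f ?z \<circ> act_B f ?z = act_B f ?z" using act_B_comp[of ?z ?z] by simp
  moreover have "inj (act_B f ?z)"
    using act_B_aut[of f ?z] by (simp add: aut_tree_def bij_is_inj)
  ultimately show ?thesis by (metis comp_apply ext id_apply injD)
qed

lemma mult_apply: "(g \<otimes>\<^bsub>G\<^esub> h) w = g (h w)"
  by (simp add: sunic_group_def aut_tree_def)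

lemma one_eq: "\<one>\<^bsub>G\<^esub> = id"
  by (simp add: sunic_group_def aut_tree_def)

lemma mult_eq: "g \<otimes>\<^bsub>G\<^esub> h = g \<circ> h"
  by (simp add: fun_eq_iff mult_apply)

lemma carrier_G: "carrier G = generate aut_tree (range act_A \<union> act_B f ` V)"
  by (simp add: sunic_group_def)

lemma act_A_in [simp]: "act_A k \<in> carrier G"
  unfolding carrier_G by (intro generate.incl) auto

lemma act_B_in [simp]: "c \<in> V \<Longrightarrow> act_B f c \<in> carrier G"
  unfolding carrier_G by (intro generate.incl) auto

lemma generators_aut: "range act_A \<union> act_B f ` V \<subseteq> carrier aut_tree"
  using act_A_aut act_B_aut by blast

lemma carrier_subset: "carrier G \<subseteq> carrier aut_tree"
  unfolding carrier_G using group.generate_incl[OF group_aut_tree generators_aut] .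

lemma bij_G: "g \<in> carrier G \<Longrightarrow> bij g"
  using carrier_subset by (auto simp: aut_tree_def)

lemma inj_G: "g \<in> carrier G \<Longrightarrow> inj g" and surj_G: "g \<in> carrier G \<Longrightarrow> surj g"
  using bij_G bij_is_inj bij_is_surj by blast+

lemma apply_Nil: "g \<in> carrier G \<Longrightarrow> g [] = []"
  using carrier_subset by (auto simp: aut_tree_def)

lemma carrier_eq_generate: "carrier G = generate G (range act_A \<union> act_B f ` V)"
proof -
  let ?S = "range act_A \<union> act_B f ` V"
  have G: "aut_tree\<lparr>carrier := carrier G\<rparr> = G" by (simp add: sunic_group_def)
  have "subgroup (carrier G) aut_tree"
    unfolding carrier_G using group.generate_is_subgroup[OF group_aut_tree generators_aut] .
  moreover have "?S \<subseteq> carrier G" by auto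
  ultimately have "generate (aut_tree\<lparr>carrier := carrier G\<rparr>) ?S = generate aut_tree ?S"
    by (intro group.generate_consistent[OF group_aut_tree])
  then show ?thesis unfolding G carrier_G[symmetric] by (rule sym)
qed

lemma inv_act_A: "inv\<^bsub>G\<^esub> act_A k = act_A (- k)"
  by (rule G.inv_equality) (auto simp: mult_eq act_A_comp act_A_0 one_eq)

lemma inv_act_B: "c \<in> V \<Longrightarrow> inv\<^bsub>G\<^esub> act_B f c = act_B f (- c)"
  by (rule G.inv_equality) (auto simp: mult_eq act_B_comp act_B_0 one_eq)

text \<open>The generating set is closed under inverses, and the identity is \<open>act_A 0\<close>,
  so neither needs a case.\<close>

lemma generators_induct [consumes 1, case_names A B mult]:
  assumes "g \<in> carrier G" "\<And>k. P (act_A k)" "\<And>c. c \<in> V \<Longrightarrow> P (act_B f c)"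
    "\<And>g h. g \<in> carrier G \<Longrightarrow> h \<in> carrier G \<Longrightarrow> P g \<Longrightarrow> P h \<Longrightarrow> P (g \<otimes>\<^bsub>G\<^esub> h)"
  shows "P g"
  using assms(1) unfolding carrier_eq_generate
proof (induction g rule: generate.induct)
  case one
  show ?case unfolding one_eq act_A_0[symmetric] by (rule assms(2))
next
  case (incl h) then show ?case using assms(2,3) by auto
next
  case (inv h)
  then show ?case using assms(2,3) inv_act_A inv_act_B by auto
next
  case (eng h1 h2)
  then show ?case using assms(4) carrier_eq_generate by auto
qed

section \<open>Copies and sections of group elements\<close>

lemma at_vertex_mult: "at_vertex u (g \<otimes>\<^bsub>G\<^esub> h) = at_vertex u g \<otimes>\<^bsub>G\<^esub> at_vertex u h"
  by (simp add: mult_eq at_vertex_comp)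

lemma at_vertex_one [simp]: "at_vertex u \<one>\<^bsub>G\<^esub> = \<one>\<^bsub>G\<^esub>"
  by (simp add: one_eq)

lemma at_vertex_inv:
  assumes "g \<in> carrier G" "at_vertex u g \<in> carrier G" "at_vertex u (inv\<^bsub>G\<^esub> g) \<in> carrier G"
  shows "at_vertex u (inv\<^bsub>G\<^esub> g) = inv\<^bsub>G\<^esub> (at_vertex u g)"
proof (rule G.inv_equality[symmetric])
  show "at_vertex u (inv\<^bsub>G\<^esub> g) \<otimes>\<^bsub>G\<^esub> at_vertex u g = \<one>\<^bsub>G\<^esub>"
    using assms(1) by (simp add: at_vertex_mult[symmetric])
qed (use assms in auto)

text \<open>Self-similarity: sections of generators are generators or trivial, and the section of a
  product at \<open>x\<close> composes the section of \<open>h\<close> at \<open>x\<close> with that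
  of \<open>g\<close> at the image letter.\<close>

lemma section_letter:
  assumes "g \<in> carrier G"
  shows "\<exists>x' h. h \<in> carrier G \<and> (\<forall>w. g (x # w) = x' # h w)"
  using assms
proof (induction g arbitrary: x rule: generators_induct)
  case (A k)
  show ?case by (intro exI[of _ "x + k"] exI[of _ "\<one>\<^bsub>G\<^esub>"] conjI G.one_closed) (simp add: one_eq)
next
  case (B c)
  define h where "h = (if x = 0 then act_A (omega f c)
    else if x = - 1 then act_B f (rho f c) else \<one>\<^bsub>G\<^esub>)"
  have "h \<in> carrier G" by (auto simp: h_def)
  moreover have "act_B f c (x # w) = x # h w" for w by (auto simp: h_def one_eq)
  ultimately show ?case by blast
next
  case (mult g h)
  obtain x' h' where h': "h' \<in> carrier G" "\<And>w. h (x # w) = x' # h' w" using mult.IH(2) by blast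
  obtain x'' g' where g': "g' \<in> carrier G" "\<And>w. g (x' # w) = x'' # g' w" using mult.IH(1) by blast
  show ?case using h' g' by (intro exI[of _ x''] exI[of _ "g' \<otimes>\<^bsub>G\<^esub> h'"] conjI allI G.m_closed)
      (simp_all add: mult_apply)
qed

lemma section_vertex:
  assumes "g \<in> carrier G"
  shows "\<exists>u' h. length u' = length u \<and> h \<in> carrier G \<and> (\<forall>w. g (u @ w) = u' @ h w)"
  using assms
proof (induction u arbitrary: g)
  case Nil
  then show ?case by auto
next
  case (Cons x u)
  obtain x' h where h: "h \<in> carrier G" "\<And>w. g (x # w) = x' # h w"
    using section_letter[OF Cons.prems] by blast
  obtain u' h' where h': "length u' = length u" "h' \<in> carrier G" "\<And>w. h (u @ w) = u' @ h' w"
    using Cons.IH[OF h(1)] by blast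
  then show ?case using h by (intro exI[of _ "x' # u'"] exI[of _ h']) simp
qed

lemma act_B_last_unit: "act_B f (k \<cdot>\<^sub>v unit_vec (degree f) (degree f - 1)) (0 # w) = 0 # act_A k w"
  using deg by (simp add: omega_def)

text \<open>Self-replication. At the letter 0, powers of \<open>a\<close> occur as sections of
  multiples of the last basis vector, and elements of \<open>B\<close> as sections of conjugates by
  \<open>a\<close>. Powers of \<open>a\<close> then change the source and target letters.\<close>

lemma exists_section_letter:
  assumes "h \<in> carrier G"
  shows "\<exists>\<gamma>\<in>carrier G. \<forall>w. \<gamma> (x # w) = x' # h w"
proof -
  have "\<exists>\<gamma>\<in>carrier G. \<forall>w. \<gamma> (0 # w) = 0 # h w"
    using assms
  proof (induction h rule: generators_induct)
    case (A k)
    show ?case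
      by (intro bexI[of _ "act_B f (k \<cdot>\<^sub>v unit_vec (degree f) (degree f - 1))"] allI act_B_last_unit) simp
  next
    case (B c)
    then have "c \<in> rho f ` V" by (simp only: rho_surj)
    then obtain d where d: "c = rho f d" "d \<in> V" by (rule imageE)
    show ?case
    \<comment> \<open>The inverse of \<open>a\<close> moves 0 to the last letter, where
      \<open>d\<close> has section \<rho>(d) = c, and \<open>a\<close> moves back.\<close>
    proof (intro bexI[of _ "act_A 1 \<otimes>\<^bsub>G\<^esub> act_B f d \<otimes>\<^bsub>G\<^esub> act_A (- 1)"] allI G.m_closed)
      show "(act_A 1 \<otimes>\<^bsub>G\<^esub> act_B f d \<otimes>\<^bsub>G\<^esub> act_A (- 1)) (0 # w) = 0 # act_B f c w" for w
        by (simp add: mult_apply d(1))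
    qed (use d(2) in simp_all)
  next
    case (mult g h)
    then obtain g' h' where "g' \<in> carrier G" "h' \<in> carrier G"
      "\<And>w. g' (0 # w) = 0 # g w" "\<And>w. h' (0 # w) = 0 # h w" by blast
    then show ?case by (intro bexI[of _ "g' \<otimes>\<^bsub>G\<^esub> h'"] allI G.m_closed) (auto simp: mult_apply)
  qed
  then obtain \<gamma> where "\<gamma> \<in> carrier G" "\<And>w. \<gamma> (0 # w) = 0 # h w" by blast
  then show ?thesis
    by (intro bexI[of _ "act_A x' \<otimes>\<^bsub>G\<^esub> \<gamma> \<otimes>\<^bsub>G\<^esub> act_A (- x)"] allI G.m_closed)
      (auto simp: mult_apply)
qed

text \<open>For trivial \<open>h\<close> this includes transitivity on every level.\<close>

lemma exists_section_vertex:
  assumes "length u = length u'" "h \<in> carrier G"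
  shows "\<exists>\<gamma>\<in>carrier G. \<forall>w. \<gamma> (u @ w) = u' @ h w"
  using assms
proof (induction u u' rule: list_induct2)
  case Nil
  then show ?case by auto
next
  case (Cons x u x' u')
  then obtain \<gamma> where \<gamma>: "\<gamma> \<in> carrier G" "\<And>w. \<gamma> (u @ w) = u' @ h w" by blast
  obtain \<gamma>' where \<gamma>': "\<gamma>' \<in> carrier G" "\<And>w. \<gamma>' (x # w) = x' # \<gamma> w"
    using exists_section_letter[OF \<gamma>(1)] by blast
  show ?case using \<gamma> \<gamma>' by (intro bexI[of _ \<gamma>']) auto
qed

text \<open>In a finite group, the injection sending \<open>h\<close> to an element with section \<open>h\<close> at the fixed
  letter \<open>0\<close> would be onto, and then \<open>a\<close> would fix that letter.\<close>

lemma infinite_G: "infinite (carrier G)"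
proof
  assume fin: "finite (carrier G)"
  have "\<forall>h\<in>carrier G. \<exists>\<gamma>. \<gamma> \<in> carrier G \<and> (\<forall>w. \<gamma> (0 # w) = 0 # h w)"
    using exists_section_letter[of _ 0 0] by blast
  then obtain \<gamma> where \<gamma>: "\<And>h. h \<in> carrier G \<Longrightarrow> \<gamma> h \<in> carrier G"
    "\<And>h w. h \<in> carrier G \<Longrightarrow> \<gamma> h (0 # w) = 0 # h w" by metis
  have "inj_on \<gamma> (carrier G)"
  proof (rule inj_onI)
    fix g h assume "g \<in> carrier G" "h \<in> carrier G" "\<gamma> g = \<gamma> h"
    then have "0 # g w = 0 # h w" for w using \<gamma>(2) by metis
    then show "g = h" by auto
  qed
  then have "\<gamma> ` carrier G = carrier G" using fin \<gamma>(1) by (intro endo_inj_surj) auto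
  then obtain h where h: "h \<in> carrier G" "\<gamma> h = act_A 1" by (metis act_A_in imageE)
  then have "act_A 1 [0] = 0 # h []" using \<gamma>(2)[OF h(1), of "[]"] by simp
  then show False by simp
qed

lemma conjugate_at_vertex:
  assumes \<gamma>: "\<gamma> \<in> carrier G" "h \<in> carrier G" "\<And>w. \<gamma> (u @ w) = u' @ h w"
    and g: "g \<in> carrier G" "at_vertex u g \<in> carrier G"
  shows "\<gamma> \<otimes>\<^bsub>G\<^esub> at_vertex u g \<otimes>\<^bsub>G\<^esub> inv\<^bsub>G\<^esub> \<gamma> = at_vertex u' (h \<otimes>\<^bsub>G\<^esub> g \<otimes>\<^bsub>G\<^esub> inv\<^bsub>G\<^esub> h)"
proof -
  let ?g' = "h \<otimes>\<^bsub>G\<^esub> g \<otimes>\<^bsub>G\<^esub> inv\<^bsub>G\<^esub> h"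
  have "?g' \<otimes>\<^bsub>G\<^esub> h = h \<otimes>\<^bsub>G\<^esub> g" using \<gamma>(2) g(1) by (simp add: G.m_assoc)
  then have "\<gamma> \<circ> at_vertex u g = at_vertex u' ?g' \<circ> \<gamma>"
    using \<gamma> inj_G surj_G by (intro at_vertex_conjugate[of \<gamma> h]) (auto simp: mult_eq)
  moreover have "\<gamma> \<circ> inv\<^bsub>G\<^esub> \<gamma> = id" using G.r_inv[OF \<gamma>(1)] by (simp add: mult_eq one_eq)
  ultimately show ?thesis by (simp add: mult_eq comp_assoc)
qed

section \<open>Reduction to a branching subgroup\<close>

definition sections_in :: "('p mod_ring list \<Rightarrow> 'p mod_ring list) set \<Rightarrow> 'p mod_ring
    \<Rightarrow> ('p mod_ring list \<Rightarrow> 'p mod_ring list) set" where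
  "sections_in M x = {g \<in> carrier G. at_vertex [x] g \<in> M}"

text \<open>By self-replication, conjugation by \<gamma> below \<open>x\<close> is induced by an
  element of \<open>G\<close> that fixes \<open>x\<close> and has section \<gamma> there.\<close>

lemma normal_sections_in:
  assumes M: "M \<lhd> G"
  shows "sections_in M x \<lhd> G"
proof -
  interpret M: normal M G by fact
  have conj: "\<gamma> \<otimes>\<^bsub>G\<^esub> g \<otimes>\<^bsub>G\<^esub> inv\<^bsub>G\<^esub> \<gamma> \<in> sections_in M x"
    if \<gamma>: "\<gamma> \<in> carrier G" and g: "g \<in> sections_in M x" for \<gamma> g
  proof -
    obtain \<Gamma> where \<Gamma>: "\<Gamma> \<in> carrier G" "\<And>w. \<Gamma> ([x] @ w) = [x] @ \<gamma> w"
      using exists_section_letter[OF \<gamma>, of x x] by auto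
    have "\<Gamma> \<otimes>\<^bsub>G\<^esub> at_vertex [x] g \<otimes>\<^bsub>G\<^esub> inv\<^bsub>G\<^esub> \<Gamma> = at_vertex [x] (\<gamma> \<otimes>\<^bsub>G\<^esub> g \<otimes>\<^bsub>G\<^esub> inv\<^bsub>G\<^esub> \<gamma>)"
      using g by (intro conjugate_at_vertex[OF \<Gamma>(1) \<gamma> \<Gamma>(2)]) (auto simp: sections_in_def)
    then show ?thesis
      using M.inv_op_closed2[OF \<Gamma>(1)] g \<gamma> by (metis (no_types, lifting) G.inv_closed G.m_closed mem_Collect_eq sections_in_def)
  qed
  have "subgroup (sections_in M x) G"
  proof
    fix g assume g: "g \<in> sections_in M x"
    \<comment> \<open>The computation uses composition of maps, since membership of the left side in
      \<open>G\<close> is not known yet.\<close>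
    have "at_vertex [x] (inv\<^bsub>G\<^esub> g) = inv\<^bsub>G\<^esub> (at_vertex [x] g)"
    proof -
      have gc: "g \<in> carrier G" "at_vertex [x] g \<in> carrier G" using g by (auto simp: sections_in_def)
      have 1: "at_vertex [x] (inv\<^bsub>G\<^esub> g) \<otimes>\<^bsub>G\<^esub> at_vertex [x] g = \<one>\<^bsub>G\<^esub>"
        using gc by (simp add: at_vertex_mult[symmetric])
      have "at_vertex [x] (inv\<^bsub>G\<^esub> g) = at_vertex [x] (inv\<^bsub>G\<^esub> g) \<circ> (at_vertex [x] g \<circ> inv\<^bsub>G\<^esub> (at_vertex [x] g))"
        using G.r_inv[OF gc(2)] by (simp add: mult_eq one_eq)
      also have "\<dots> = inv\<^bsub>G\<^esub> (at_vertex [x] g)"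
        using 1 by (simp add: mult_eq one_eq comp_assoc[symmetric])
      finally show ?thesis .
    qed
    then show "inv\<^bsub>G\<^esub> g \<in> sections_in M x" using g by (simp add: sections_in_def)
  qed (auto simp: sections_in_def at_vertex_mult)
  with conj show ?thesis by (rule G.normal_invI[rotated])
qed

text \<open>A map fixing the first level is the product of the copies of its sections;
  \<open>r X\<close> is the partial product over the letters in \<open>X\<close>.\<close>

lemma fixes_letters_imp_in:
  assumes M: "subgroup M G" and g: "\<And>x w. g (x # w) = x # s x w" "g [] = []"
    and s: "\<And>x. at_vertex [x] (s x) \<in> M"
  shows "g \<in> M"
proof -
  define r where "r X w = (case w of [] \<Rightarrow> [] | x # v \<Rightarrow> if x \<in> X then g w else w)" for X w
  have "r X \<in> M" if "finite X" for X
    using that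
  proof (induction X rule: finite_induct)
    case empty
    have "r {} = \<one>\<^bsub>G\<^esub>" by (auto simp: r_def one_eq fun_eq_iff split: list.split)
    then show ?case using M by (simp add: subgroup.one_closed)
  next
    case (insert x X)
    have "r (insert x X) = at_vertex [x] (s x) \<otimes>\<^bsub>G\<^esub> r X"
    proof
      fix w
      show "r (insert x X) w = (at_vertex [x] (s x) \<otimes>\<^bsub>G\<^esub> r X) w"
        using insert.hyps by (cases w) (auto simp: r_def g mult_apply)
    qed
    then show ?case using insert.IH s M by (simp add: subgroup.m_closed)
  qed
  then have "r UNIV \<in> M" by simp
  moreover have "r UNIV = g" using g(2) by (auto simp: r_def fun_eq_iff split: list.split)
  ultimately show ?thesis by simp
qed

text \<open>A coset of \<open>M\<close> is determined by the action on the first level and the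
  cosets of the sections: if these agree for \<open>g\<close> and \<open>h\<close>, then g h^-1
  fixes the first level and the copies of its sections lie in \<open>M\<close>.\<close>

lemma finite_index_step:
  assumes M: "M \<lhd> G" and fin: "\<And>x. finite (carrier (G Mod (sections_in M x)))"
  shows "finite (carrier (G Mod M))"
proof -
  let ?L = "sections_in M"
  have L: "subgroup (?L x) G" for x using normal_sections_in[OF M] normal_imp_subgroup by blast
  have "\<forall>g\<in>carrier G. \<forall>x. \<exists>x' h. h \<in> carrier G \<and> (\<forall>w. g (x # w) = x' # h w)"
    using section_letter by blast
  then obtain \<pi> s where \<pi>s: "\<And>g x. g \<in> carrier G \<Longrightarrow> s g x \<in> carrier G"
    "\<And>g x w. g \<in> carrier G \<Longrightarrow> g (x # w) = \<pi> g x # s g x w" by metis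
  \<comment> \<open>The subgroup is taken at the image letter \<open>\<pi> g x\<close>, because that
    is where g h^-1 has the section obtained from \<open>s g x\<close> and the inverse of
    \<open>s h x\<close>.\<close>
  define \<phi> where "\<phi> g = (\<lambda>x. (\<pi> g x, ?L (\<pi> g x) #>\<^bsub>G\<^esub> s g x))" for g
  show ?thesis
  proof (rule G.finite_FactGroupI[OF normal_imp_subgroup[OF M], of \<phi>])
    let ?T = "\<Union>x. carrier (G Mod (?L x))"
    have "\<phi> ` carrier G \<subseteq> {F. \<forall>x. F x \<in> UNIV \<times> ?T}"
      using \<pi>s(1) by (force simp: \<phi>_def FactGroup_def RCOSETS_def)
    moreover have "finite {F. \<forall>x :: 'p mod_ring. F x \<in> (UNIV :: 'p mod_ring set) \<times> ?T}"
      using fin finite_set_of_finite_funs[of "UNIV :: 'p mod_ring set" "(UNIV :: 'p mod_ring set) \<times> ?T"]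
      by simp
    ultimately show "finite (\<phi> ` carrier G)" by (rule finite_subset)
    fix g h assume g: "g \<in> carrier G" and h: "h \<in> carrier G" and eq: "\<phi> g = \<phi> h"
    have "\<pi> g x = \<pi> h x \<and> ?L (\<pi> g x) #>\<^bsub>G\<^esub> s g x = ?L (\<pi> h x) #>\<^bsub>G\<^esub> s h x" for x
      using fun_cong[OF eq, of x] unfolding \<phi>_def prod.inject .
    note \<pi> = this[THEN conjunct1] and cos = this[THEN conjunct2, unfolded this[THEN conjunct1]]
    have hinv: "h ((inv\<^bsub>G\<^esub> h) w) = w" for w
      using fun_cong[OF G.r_inv[OF h], of w] by (simp add: one_eq mult_apply)
    have "\<exists>t. (\<forall>w. (g \<otimes>\<^bsub>G\<^esub> inv\<^bsub>G\<^esub> h) (x # w) = x # t w) \<and> t \<in> ?L x" for x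
    proof -
      obtain x' k where k: "k \<in> carrier G" "\<And>w. (inv\<^bsub>G\<^esub> h) (x # w) = x' # k w"
        using section_letter[of "inv\<^bsub>G\<^esub> h" x] h by auto
      have eq: "x # w = \<pi> h x' # s h x' (k w)" for w
        using hinv[of "x # w"] k \<pi>s(2)[OF h] by simp
      then have x: "\<pi> h x' = x" and "s h x' \<otimes>\<^bsub>G\<^esub> k = \<one>\<^bsub>G\<^esub>"
        by (auto simp: fun_eq_iff one_eq mult_apply)
      then have "k = inv\<^bsub>G\<^esub> (s h x')"
        using k(1) \<pi>s(1)[OF h] by (metis G.inv_equality G.inv_inv)
      then have "s g x' \<otimes>\<^bsub>G\<^esub> k \<in> ?L x"
        using cos[of x'] G.rcoset_eq_iff[OF L \<pi>s(1)[OF g] \<pi>s(1)[OF h]] x \<pi> by metis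
      moreover have "(g \<otimes>\<^bsub>G\<^esub> inv\<^bsub>G\<^esub> h) (x # w) = x # (s g x' \<otimes>\<^bsub>G\<^esub> k) w" for w
        using k(2) \<pi>s(2)[OF g] x \<pi> by (simp add: mult_apply)
      ultimately show ?thesis by blast
    qed
    then obtain t where t: "\<And>x w. (g \<otimes>\<^bsub>G\<^esub> inv\<^bsub>G\<^esub> h) (x # w) = x # t x w" "\<And>x. t x \<in> ?L x"
      by metis
    show "g \<otimes>\<^bsub>G\<^esub> inv\<^bsub>G\<^esub> h \<in> M"
    proof (rule fixes_letters_imp_in[OF normal_imp_subgroup[OF M]])
      show "(g \<otimes>\<^bsub>G\<^esub> inv\<^bsub>G\<^esub> h) (x # w) = x # t x w" for x w by (rule t(1))
      show "(g \<otimes>\<^bsub>G\<^esub> inv\<^bsub>G\<^esub> h) [] = []" using g h by (intro apply_Nil) simp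
      show "at_vertex [x] (t x) \<in> M" for x using t(2)[of x] by (simp add: sections_in_def)
    qed
  qed
qed

text \<open>The induction splits off the first letter of each vertex and replaces \<open>N\<close>
  by its pullbacks \<open>sections_in N x\<close>. The condition on shorter words places the copies
  in \<open>G\<close>, as membership in a pullback demands.\<close>

lemma finite_index_level:
  assumes "Q \<lhd> G" "finite (carrier (G Mod Q))" "N \<lhd> G"
    and "\<And>u q. length u = n \<Longrightarrow> q \<in> Q \<Longrightarrow> at_vertex u q \<in> N"
    and "\<And>u q. length u < n \<Longrightarrow> q \<in> Q \<Longrightarrow> at_vertex u q \<in> carrier G"
  shows "finite (carrier (G Mod N))"
  using assms(3-5)
proof (induction n arbitrary: N)
  case 0
  have "Q \<subseteq> N"
  proof
    fix q assume "q \<in> Q"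
    moreover have "at_vertex [] q = q" by auto
    ultimately show "q \<in> N" using 0(2)[of "[]" q] by simp
  qed
  then show ?case
    using G.finite_FactGroup_mono[OF _ _ _ assms(2)] assms(1) 0(1) normal_imp_subgroup by blast
next
  case (Suc n)
  have in_sections: "at_vertex u q \<in> sections_in N x" if "length u = n" "q \<in> Q" for u q x
    using Suc.prems(2)[of "x # u" q] Suc.prems(3)[of u q] that at_vertex_Cons[of x u q]
    by (simp add: sections_in_def)
  show ?case
  proof (rule finite_index_step[OF Suc.prems(1)])
    fix x
    show "finite (carrier (G Mod (sections_in N x)))"
    proof (rule Suc.IH[OF normal_sections_in[OF Suc.prems(1)]])
      show "length u = n \<Longrightarrow> q \<in> Q \<Longrightarrow> at_vertex u q \<in> sections_in N x" for u q
        by (rule in_sections)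
      show "length u < n \<Longrightarrow> q \<in> Q \<Longrightarrow> at_vertex u q \<in> carrier G" for u :: "'p mod_ring list" and q
        by (rule Suc.prems(3)[OF less_SucI])
    qed
  qed
qed

text \<open>If \<open>g \<in> N\<close> moves \<open>u\<close>, then \<open>[g, h]\<close> acts as \<open>h\<^sup>-\<^sup>1\<close> below \<open>u\<close> for \<open>h\<close> supported below \<open>u\<close>,
  and a second commutator removes its part below \<open>g u\<close>.\<close>

lemma commutator_at_vertex_in:
  assumes N: "N \<lhd> G" and g: "g \<in> N" "g u \<noteq> u"
    and hk: "h \<in> carrier G" "k \<in> carrier G" "at_vertex u h \<in> carrier G" "at_vertex u k \<in> carrier G"
      "at_vertex u (inv\<^bsub>G\<^esub> h) \<in> carrier G" "at_vertex u (inv\<^bsub>G\<^esub> k) \<in> carrier G"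
  shows "at_vertex u (h \<otimes>\<^bsub>G\<^esub> k \<otimes>\<^bsub>G\<^esub> inv\<^bsub>G\<^esub> h \<otimes>\<^bsub>G\<^esub> inv\<^bsub>G\<^esub> k) \<in> N"
proof -
  interpret N: normal N G by fact
  let ?H = "at_vertex u h" and ?K = "at_vertex u k"
  have gc: "g \<in> carrier G" using g by simp
  obtain u' s where s: "length u' = length u" "s \<in> carrier G" "\<And>w. g (u @ w) = u' @ s w"
    using section_vertex[OF gc] by blast
  have "g u = u'" using s(3)[of "[]"] apply_Nil[OF s(2)] by simp
  then have u': "u' \<noteq> u" using g by simp
  \<comment> \<open>The commutator of \<open>?H\<close> and \<open>g\<close> is \<open>?H\<close>
    times \<open>L\<close>. As \<open>L\<close> is supported below u', it commutes with everything
    supported below \<open>u\<close> and drops out of the commutator with \<open>?K\<close>.\<close>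
  define L where "L = g \<otimes>\<^bsub>G\<^esub> inv\<^bsub>G\<^esub> ?H \<otimes>\<^bsub>G\<^esub> inv\<^bsub>G\<^esub> g"
  have Lc: "L \<in> carrier G" using gc hk by (simp add: L_def)
  have "L = at_vertex u' (s \<otimes>\<^bsub>G\<^esub> inv\<^bsub>G\<^esub> h \<otimes>\<^bsub>G\<^esub> inv\<^bsub>G\<^esub> s)"
    using conjugate_at_vertex[OF gc s(2,3), of "inv\<^bsub>G\<^esub> h"] hk at_vertex_inv[of h u]
    by (simp add: L_def)
  then have comm: "L \<otimes>\<^bsub>G\<^esub> at_vertex u l = at_vertex u l \<otimes>\<^bsub>G\<^esub> L" for l
    using at_vertex_commute[OF s(1) u'] by (simp add: mult_eq)
  have "?H \<otimes>\<^bsub>G\<^esub> (g \<otimes>\<^bsub>G\<^esub> inv\<^bsub>G\<^esub> ?H \<otimes>\<^bsub>G\<^esub> inv\<^bsub>G\<^esub> g) \<in> N"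
  proof -
    have "(?H \<otimes>\<^bsub>G\<^esub> g \<otimes>\<^bsub>G\<^esub> inv\<^bsub>G\<^esub> ?H) \<otimes>\<^bsub>G\<^esub> inv\<^bsub>G\<^esub> g \<in> N"
      using N.inv_op_closed2 g hk by simp
    then show ?thesis using gc hk by (simp add: G.m_assoc)
  qed
  then have c: "?H \<otimes>\<^bsub>G\<^esub> L \<in> N" by (simp add: L_def)
  have "(?H \<otimes>\<^bsub>G\<^esub> L) \<otimes>\<^bsub>G\<^esub> (?K \<otimes>\<^bsub>G\<^esub> inv\<^bsub>G\<^esub> (?H \<otimes>\<^bsub>G\<^esub> L) \<otimes>\<^bsub>G\<^esub> inv\<^bsub>G\<^esub> ?K) \<in> N"
    using c N.inv_op_closed2[of ?K "inv\<^bsub>G\<^esub> (?H \<otimes>\<^bsub>G\<^esub> L)"] hk by simp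
  also have "(?H \<otimes>\<^bsub>G\<^esub> L) \<otimes>\<^bsub>G\<^esub> (?K \<otimes>\<^bsub>G\<^esub> inv\<^bsub>G\<^esub> (?H \<otimes>\<^bsub>G\<^esub> L) \<otimes>\<^bsub>G\<^esub> inv\<^bsub>G\<^esub> ?K)
      = ?H \<otimes>\<^bsub>G\<^esub> (L \<otimes>\<^bsub>G\<^esub> ?K) \<otimes>\<^bsub>G\<^esub> inv\<^bsub>G\<^esub> L \<otimes>\<^bsub>G\<^esub> inv\<^bsub>G\<^esub> ?H \<otimes>\<^bsub>G\<^esub> inv\<^bsub>G\<^esub> ?K"
    using Lc hk by (simp add: G.m_assoc G.inv_mult_group)
  also have "\<dots> = ?H \<otimes>\<^bsub>G\<^esub> ?K \<otimes>\<^bsub>G\<^esub> inv\<^bsub>G\<^esub> ?H \<otimes>\<^bsub>G\<^esub> inv\<^bsub>G\<^esub> ?K"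
    unfolding comm using Lc hk by (simp add: G.m_assoc)
  finally show ?thesis
    by (simp add: at_vertex_mult at_vertex_inv[OF hk(1,3,5)] at_vertex_inv[OF hk(2,4,6)])
qed

text \<open>A nontrivial element of \<open>N\<close> moves some \<open>v\<close>. Level transitivity
  provides conjugates in \<open>N\<close> moving any other vertex of that level, so \<open>N\<close>
  contains the copies of \<open>derived G K\<close> at the whole level and
  \<open>finite_index_level\<close> applies.\<close>

lemma finite_quotient_if_branching:
  assumes K: "K \<lhd> G" "\<And>x k. k \<in> K \<Longrightarrow> at_vertex [x] k \<in> K"
    and fin: "finite (carrier (G Mod (derived G K)))"
    and N: "N \<lhd> G" "N \<noteq> {\<one>\<^bsub>G\<^esub>}"
  shows "finite (carrier (G Mod N))"
proof -
  interpret K: normal K G by fact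
  interpret N: normal N G by fact
  have at_K: "at_vertex u k \<in> K" if "k \<in> K" for u k
    using that
  proof (induction u)
    case Nil
    moreover have "at_vertex [] k = k" by auto
    ultimately show ?case by simp
  next
    case (Cons x u) then show ?case using K(2) at_vertex_Cons[of x u k] by simp
  qed
  obtain g where g: "g \<in> N" "g \<noteq> \<one>\<^bsub>G\<^esub>" using N(2) N.one_closed by blast
  then obtain v where v: "g v \<noteq> v" by (auto simp: one_eq fun_eq_iff)
  have D: "derived G K \<lhd> G" using G.derived_is_normal[OF K(1)] .
  have D_sub: "derived G K \<subseteq> K" using G.derived_incl[OF _ K.subgroup_axioms] by simp
  show ?thesis
  proof (rule finite_index_level[OF D fin N(1), of "length v"])
    fix u :: "'p mod_ring list" and q assume "length u < length v" "q \<in> derived G K"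
    then show "at_vertex u q \<in> carrier G" using at_K D_sub by auto
  next
    fix u :: "'p mod_ring list" and q assume u: "length u = length v" and q: "q \<in> derived G K"
    \<comment> \<open>Since \<gamma> takes \<open>v\<close> to \<open>u\<close>, conjugation by it
      turns \<open>g\<close> into an element of \<open>N\<close> that moves
      \<open>u\<close>.\<close>
    obtain \<gamma> where \<gamma>: "\<gamma> \<in> carrier G" "\<And>w. \<gamma> (v @ w) = u @ \<one>\<^bsub>G\<^esub> w"
      using exists_section_vertex[of v u "\<one>\<^bsub>G\<^esub>"] u by auto
    define g' where "g' = \<gamma> \<otimes>\<^bsub>G\<^esub> g \<otimes>\<^bsub>G\<^esub> inv\<^bsub>G\<^esub> \<gamma>"
    have g': "g' \<in> N" using N.inv_op_closed2[OF \<gamma>(1) g(1)] by (simp add: g'_def)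
    have \<gamma>v: "\<gamma> v = u" using \<gamma>(2)[of "[]"] by (simp add: one_eq)
    have "(inv\<^bsub>G\<^esub> \<gamma>) u = v" using fun_cong[OF G.l_inv[OF \<gamma>(1)], of v] \<gamma>v by (simp add: one_eq mult_apply)
    then have "g' u = \<gamma> (g v)" by (simp add: g'_def mult_apply)
    then have g'_u: "g' u \<noteq> u" using v \<gamma>v inj_G[OF \<gamma>(1)] by (metis injD)
    show "at_vertex u q \<in> N"
      using q unfolding derived_def
    proof (induction q rule: generate.induct)
      case one then show ?case by simp
    next
      case (incl h)
      then obtain k l where "k \<in> K" "l \<in> K" "h = k \<otimes>\<^bsub>G\<^esub> l \<otimes>\<^bsub>G\<^esub> inv\<^bsub>G\<^esub> k \<otimes>\<^bsub>G\<^esub> inv\<^bsub>G\<^esub> l" by blast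
      then show ?case using commutator_at_vertex_in[OF N(1) g' g'_u] at_K by simp
    next
      case (inv h)
      then obtain k l where kl: "k \<in> K" "l \<in> K" "h = k \<otimes>\<^bsub>G\<^esub> l \<otimes>\<^bsub>G\<^esub> inv\<^bsub>G\<^esub> k \<otimes>\<^bsub>G\<^esub> inv\<^bsub>G\<^esub> l" by blast
      then have "inv\<^bsub>G\<^esub> h = l \<otimes>\<^bsub>G\<^esub> k \<otimes>\<^bsub>G\<^esub> inv\<^bsub>G\<^esub> l \<otimes>\<^bsub>G\<^esub> inv\<^bsub>G\<^esub> k"
        by (simp add: G.inv_mult_group G.m_assoc)
      then show ?case using commutator_at_vertex_in[OF N(1) g' g'_u, of l k] at_K kl by simp
    next
      case (eng h1 h2) then show ?case by (simp add: at_vertex_mult)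
    qed
  qed
qed

section \<open>The branching subgroup\<close>

abbreviation "a \<equiv> act_A (1 :: 'p mod_ring)"

abbreviation "comm g h \<equiv> g \<otimes>\<^bsub>G\<^esub> h \<otimes>\<^bsub>G\<^esub> inv\<^bsub>G\<^esub> g \<otimes>\<^bsub>G\<^esub> inv\<^bsub>G\<^esub> h"

definition b_last :: "'p mod_ring vec" where "b_last = unit_vec (degree f) (degree f - 1)"

lemma b_last_in [simp]: "b_last \<in> V" by (simp add: b_last_def)

lemma omega_smult_b_last [simp]: "omega f (k \<cdot>\<^sub>v b_last) = k"
  using deg by (simp add: omega_def b_last_def)

lemma omega_b_last [simp]: "omega f b_last = 1"
  using deg by (simp add: omega_def b_last_def)

lemma dim_rho [simp]: "dim_vec (rho f c) = degree f"
  using carrier_vecD[OF rho_carrier] .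

lemma rho_uminus: assumes c: "c \<in> V" shows "rho f (- c) = - rho f c"
proof (rule eq_vecI)
  fix i assume "i < dim_vec (- rho f c)"
  then have i: "i < degree f" by simp
  have om: "omega f (- c) = - omega f c" using c deg by (simp add: omega_def)
  show "rho f (- c) $ i = (- rho f c) $ i"
    using rho_index[OF c i] rho_index[of "- c" i] c i om by simp
qed simp

lemma omega_uminus: "c \<in> V \<Longrightarrow> omega f (- c) = - omega f c"
  using deg by (simp add: omega_def)

lemma act_A_cancel [simp]: "act_A k (act_A (- k) w) = w" "act_A (- k) (act_A k w) = w"
  by (cases w; simp)+

lemma act_B_cancel [simp]: "c \<in> V \<Longrightarrow> act_B f c (act_B f (- c) w) = w"
  "c \<in> V \<Longrightarrow> act_B f (- c) (act_B f c w) = w"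
  using fun_cong[OF act_B_comp[of c "- c"], of w] fun_cong[OF act_B_comp[of "- c" c], of w]
  by (simp_all add: act_B_0)

lemma act_B_commute: "c \<in> V \<Longrightarrow> d \<in> V \<Longrightarrow> act_B f c \<otimes>\<^bsub>G\<^esub> act_B f d = act_B f d \<otimes>\<^bsub>G\<^esub> act_B f c"
  by (simp add: mult_eq act_B_comp comm_add_vec[of c])

lemma inv_act_apply: "c \<in> V \<Longrightarrow> (inv\<^bsub>G\<^esub> act_B f c) w = act_B f (- c) w" "(inv\<^bsub>G\<^esub> act_A k) w = act_A (- k) w"
  by (simp_all add: inv_act_A inv_act_B)

text \<open>The conjugate of \<open>c\<close> by \<open>a\<close> has sections \<open>\<rho>(c)\<close> at \<open>0\<close> and \<open>\<omega>(c)\<close> at \<open>1\<close>, while \<open>b\<close> has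
  sections \<open>a\<close> at \<open>0\<close> and \<open>\<rho>(b)\<close> at \<open>-1\<close>. The letters \<open>1\<close> and \<open>-1\<close> interfere for \<open>p = 2\<close>.\<close>

lemma commutator_section:
  assumes c: "c \<in> V" and p: "CARD('p) \<noteq> 2 \<or> omega f c = 0"
  shows "comm (act_B f b_last) (a \<otimes>\<^bsub>G\<^esub> act_B f c \<otimes>\<^bsub>G\<^esub> inv\<^bsub>G\<^esub> a)
    = at_vertex [0] (comm a (act_B f (rho f c)))" (is "?L = ?R")
proof
  fix w
  have inv: "inv\<^bsub>G\<^esub> (a \<otimes>\<^bsub>G\<^esub> act_B f c \<otimes>\<^bsub>G\<^esub> inv\<^bsub>G\<^esub> a) = a \<otimes>\<^bsub>G\<^esub> inv\<^bsub>G\<^esub> act_B f c \<otimes>\<^bsub>G\<^esub> inv\<^bsub>G\<^esub> a"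
    using c by (simp add: G.inv_mult_group G.m_assoc)
  have L: "?L w = act_B f b_last (a (act_B f c (act_A (- 1) (act_B f (- b_last)
    (a (act_B f (- c) (act_A (- 1) w)))))))"
    unfolding inv using c by (simp add: mult_apply inv_act_apply)
  have rho_l: "rho f (- b_last) = - rho f b_last" and rho_c: "rho f (- c) = - rho f c"
    using rho_uminus c by auto
  have om: "omega f (- b_last) = - 1" "omega f (- c) = - omega f c"
    using omega_uminus c by auto
  note simps = rho_l rho_c om inv_act_apply mult_apply
  show "?L w = ?R w"
  proof (cases w)
    case Nil
    then show ?thesis unfolding L by (simp only: Nil act_A.simps act_B.simps at_vertex.simps)
  next
    case (Cons x v)
    consider "x = 0" | "x = 1" "x \<noteq> 0" | "x \<noteq> 0" "x \<noteq> 1" by blast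
    then show ?thesis
    proof cases
      case 1
      then show ?thesis unfolding L unfolding Cons by (simp add: simps)
    next
      case 2
      show ?thesis
      proof (cases "CARD('p) = 2")
        case True
        then have "omega f c = 0" "(-1 :: 'p mod_ring) = 1"
          using p mod_ring_one_eq_minus_one_iff[where 'p = 'p] by auto
        then show ?thesis unfolding L unfolding Cons using 2 by (simp add: simps act_A_0)
      next
        case False
        then have "(1 :: 'p mod_ring) \<noteq> - 1" using mod_ring_one_eq_minus_one_iff by blast
        then show ?thesis unfolding L unfolding Cons using 2 by (simp add: simps)
      qed
    next
      case 3
      \<comment> \<open>The inverse of \<open>a\<close> sends \<open>x\<close> to a letter other
        than 0 and -1. There \<open>c\<close> acts trivially, so the two occurrences of
        \<open>b_last\<close> cancel.\<close>
      have shift: "act_A (- 1) (x # u) = (x - 1) # u" "a ((x - 1) # u) = x # u" for u by simp_all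
      have fixd: "act_B f d ((x - 1) # u) = (x - 1) # u" for d u using 3 by simp
      obtain u where u: "act_B f (- b_last) (x # v) = x # u" using 3(1) by (cases "x = - 1") auto
      have "act_B f b_last (x # u) = x # v" using act_B_cancel(1)[OF b_last_in, of "x # v"] u by simp
      then have "?L w = x # v" unfolding L unfolding Cons shift fixd u .
      then show ?thesis using Cons 3 by simp
    qed
  qed
qed

text \<open>For \<open>p = 2\<close> the condition \<open>y $ 0 = 0\<close> describes the image of the kernel of \<open>\<omega>\<close> under \<open>\<rho>\<close>.\<close>

definition C :: "'p mod_ring vec set" where
  "C = {y \<in> V. CARD('p) = 2 \<longrightarrow> y $ 0 = 0}"

lemma C_sub: "C \<subseteq> V" by (auto simp: C_def)

text \<open>For p = 2, coordinate 0 of \<rho>(c) is -a_0 \<omega>(c), which vanishes only when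
  \<omega>(c) does.\<close>

lemma C_preimage:
  assumes "y \<in> C"
  obtains c where "c \<in> V" "rho f c = y" "CARD('p) \<noteq> 2 \<or> omega f c = 0"
proof -
  have "y \<in> rho f ` V" unfolding rho_surj using assms C_sub by (rule rev_subsetD)
  then obtain c where c: "y = rho f c" "c \<in> V" by (rule imageE)
  have "CARD('p) \<noteq> 2 \<or> omega f c = 0"
    using rho_index[OF c(2), of 0] assms deg coeff_0 unfolding c(1) by (auto simp: C_def)
  then show ?thesis by (rule that[OF c(2) c(1)[symmetric]])
qed

definition K where
  "K = generate G (\<Union>g\<in>carrier G. (\<lambda>e. g \<otimes>\<^bsub>G\<^esub> e \<otimes>\<^bsub>G\<^esub> inv\<^bsub>G\<^esub> g) ` (\<lambda>y. comm a (act_B f y)) ` C)"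

lemma commutators_carrier: "(\<lambda>y. comm a (act_B f y)) ` C \<subseteq> carrier G"
  using C_sub by auto

lemma K_normal: "K \<lhd> G"
  unfolding K_def by (rule G.normal_generate_conjugates[OF commutators_carrier])

lemma commutator_in_K:
  assumes "y \<in> C"
  shows "comm a (act_B f y) \<in> K"
proof -
  have y: "act_B f y \<in> carrier G" using assms C_sub by auto
  have "\<one>\<^bsub>G\<^esub> \<otimes>\<^bsub>G\<^esub> comm a (act_B f y) \<otimes>\<^bsub>G\<^esub> inv\<^bsub>G\<^esub> \<one>\<^bsub>G\<^esub> \<in> K"
    unfolding K_def using assms by (intro generate.incl) blast
  then show ?thesis using y by simp
qed

text \<open>As \<open>sections_in K x\<close> is a subgroup, it suffices to treat the conjugates
  generating \<open>K\<close>. Because [a, \<open>b_last\<close>] lies in \<open>K\<close>,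
  \<open>commutator_conjugate_in\<close> and \<open>commutator_section\<close> put the copy of
  [a, y] at 0 into \<open>K\<close>; conjugation by an element with section \<open>g\<close> from 0
  to \<open>x\<close> does the rest.\<close>

lemma K_branching:
  assumes l: "b_last \<in> C" and k: "k \<in> K"
  shows "at_vertex [x] k \<in> K"
proof -
  interpret K: normal K G by (rule K_normal)
  interpret L: normal "sections_in K x" G by (rule normal_sections_in[OF K_normal])
  have "g \<otimes>\<^bsub>G\<^esub> comm a (act_B f y) \<otimes>\<^bsub>G\<^esub> inv\<^bsub>G\<^esub> g \<in> sections_in K x"
    if g: "g \<in> carrier G" and y: "y \<in> C" for g y
  proof -
    obtain c where c: "c \<in> V" "rho f c = y" "CARD('p) \<noteq> 2 \<or> omega f c = 0"
      using C_preimage[OF y] by blast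
    let ?e = "comm a (act_B f y)"
    have e: "?e \<in> carrier G" using commutators_carrier y by auto
    have "act_B f b_last \<otimes>\<^bsub>G\<^esub> act_B f c = act_B f c \<otimes>\<^bsub>G\<^esub> act_B f b_last"
      using act_B_commute c by simp
    then have "comm (act_B f b_last) (a \<otimes>\<^bsub>G\<^esub> act_B f c \<otimes>\<^bsub>G\<^esub> inv\<^bsub>G\<^esub> a) \<in> K"
      using commutator_in_K[OF l] c by (intro K.commutator_conjugate_in) auto
    then have at_e: "at_vertex [0] ?e \<in> K" using commutator_section[OF c(1,3)] c(2) by simp
    obtain \<gamma> where \<gamma>: "\<gamma> \<in> carrier G" "\<And>w. \<gamma> ([0] @ w) = [x] @ g w"
      using exists_section_letter[OF g, of 0 x] by auto
    have "\<gamma> \<otimes>\<^bsub>G\<^esub> at_vertex [0] ?e \<otimes>\<^bsub>G\<^esub> inv\<^bsub>G\<^esub> \<gamma> = at_vertex [x] (g \<otimes>\<^bsub>G\<^esub> ?e \<otimes>\<^bsub>G\<^esub> inv\<^bsub>G\<^esub> g)"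
      using at_e e by (intro conjugate_at_vertex[OF \<gamma>(1) g \<gamma>(2)]) auto
    moreover have "\<gamma> \<otimes>\<^bsub>G\<^esub> at_vertex [0] ?e \<otimes>\<^bsub>G\<^esub> inv\<^bsub>G\<^esub> \<gamma> \<in> K"
      using K.inv_op_closed2[OF \<gamma>(1) at_e] .
    ultimately show ?thesis using g e unfolding sections_in_def by simp
  qed
  then have "(\<Union>g\<in>carrier G. (\<lambda>e. g \<otimes>\<^bsub>G\<^esub> e \<otimes>\<^bsub>G\<^esub> inv\<^bsub>G\<^esub> g) ` (\<lambda>y. comm a (act_B f y)) ` C) \<subseteq> sections_in K x"
    by blast
  from G.generate_subgroup_incl[OF this L.subgroup_axioms, folded K_def]
  have "k \<in> sections_in K x" using k by (rule subsetD)
  then show ?thesis unfolding sections_in_def by blast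
qed

section \<open>Generation by \<open>a\<close> and \<open>B\<close>, and centrality of
  \<open>C\<close> modulo \<open>K\<close>\<close>

lemma a_pow: "a [^]\<^bsub>G\<^esub> n = act_A (of_nat n)" for n :: nat
  by (induction n) (auto simp: act_A_0 one_eq mult_eq act_A_comp)

lemma carrier_eq_generate_a: "carrier G = generate G (insert a (act_B f ` V))"
proof
  have S: "insert a (act_B f ` V) \<subseteq> carrier G" by auto
  then show "generate G (insert a (act_B f ` V)) \<subseteq> carrier G" by (rule G.generate_incl)
  interpret S: subgroup "generate G (insert a (act_B f ` V))" G by (rule G.generate_is_subgroup[OF S])
  show "carrier G \<subseteq> generate G (insert a (act_B f ` V))"
  proof
    fix g assume "g \<in> carrier G"
    then show "g \<in> generate G (insert a (act_B f ` V))"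
    proof (induction g rule: generators_induct)
      case (A k)
      obtain i where "k = of_nat i" using surj_of_nat_mod_ring by blast
      moreover have "a [^]\<^bsub>G\<^esub> i \<in> generate G (insert a (act_B f ` V))" for i :: nat
        by (induction i) (auto intro: generate.incl)
      ultimately show ?case by (metis a_pow)
    next
      case (B c) then show ?case by (intro generate.incl) auto
    qed simp
  qed
qed

lemma subgroup_act_B:
  assumes "W \<subseteq> V" "0\<^sub>v (degree f) \<in> W" "\<And>c d. c \<in> W \<Longrightarrow> d \<in> W \<Longrightarrow> c + d \<in> W" "\<And>c. c \<in> W \<Longrightarrow> - c \<in> W"
  shows "subgroup (act_B f ` W) G"
proof
  show "act_B f ` W \<subseteq> carrier G" using assms(1) by auto
  show "\<one>\<^bsub>G\<^esub> \<in> act_B f ` W" unfolding one_eq act_B_0[symmetric] using assms(2) by (rule imageI)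
  fix x y assume "x \<in> act_B f ` W" "y \<in> act_B f ` W"
  then obtain c d where cd: "c \<in> W" "d \<in> W" "x = act_B f c" "y = act_B f d" by auto
  then have "x \<otimes>\<^bsub>G\<^esub> y = act_B f (c + d)" using assms(1) act_B_comp by (auto simp: mult_eq)
  then show "x \<otimes>\<^bsub>G\<^esub> y \<in> act_B f ` W" using cd assms(3) by auto
  have "inv\<^bsub>G\<^esub> x = act_B f (- c)" using cd assms(1) inv_act_B by auto
  then show "inv\<^bsub>G\<^esub> x \<in> act_B f ` W" using cd assms(4) by auto
qed

text \<open>Modulo \<open>K\<close> an element of \<open>C\<close> commutes with \<open>a\<close> by
  construction and with the abelian group \<open>B\<close>, hence is central.\<close>

lemma commutator_with_C_in_K:
  assumes y: "y \<in> C" and g: "g \<in> carrier G"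
  shows "comm g (act_B f y) \<in> K"
proof -
  interpret K: normal K G by (rule K_normal)
  have y': "act_B f y \<in> carrier G" "y \<in> V" using y C_sub by auto
  note assoc = G.m_assoc G.inv_mult_group G.inv_mult_cancel
  have step: "comm (g \<otimes>\<^bsub>G\<^esub> h) (act_B f y) \<in> K"
    if "g \<in> carrier G" "h \<in> carrier G" "comm g (act_B f y) \<in> K" "comm h (act_B f y) \<in> K" for g h
  proof -
    have "comm (g \<otimes>\<^bsub>G\<^esub> h) (act_B f y)
      = (g \<otimes>\<^bsub>G\<^esub> comm h (act_B f y) \<otimes>\<^bsub>G\<^esub> inv\<^bsub>G\<^esub> g) \<otimes>\<^bsub>G\<^esub> comm g (act_B f y)"
      using that(1,2) y' by (simp add: assoc)
    then show ?thesis using that K.inv_op_closed2 by simp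
  qed
  show ?thesis
    using g
  proof (induction g rule: generators_induct)
    case (A k)
    obtain i where k: "k = of_nat i" using surj_of_nat_mod_ring by blast
    have "comm (a [^]\<^bsub>G\<^esub> i) (act_B f y) \<in> K" for i :: nat
    proof (induction i)
      case (Suc i)
      then show ?case using step[of "a [^]\<^bsub>G\<^esub> i" a] commutator_in_K[OF y] by simp
    qed (use y' in simp)
    then show ?case using k a_pow by metis
  next
    case (B c)
    have "comm (act_B f c) (act_B f y) = \<one>\<^bsub>G\<^esub>"
      using B y' act_B_commute[OF B y'(2)] by (simp add: assoc)
    then show ?case by simp
  next
    case (mult g h) then show ?case by (rule step)
  qed
qed

section \<open>The derived subgroup of \<open>K\<close>, odd case\<close>

text \<open>The section of \<open>[a, d]\<close> at \<open>1\<close> is \<open>\<omega>(d)\<close> and the one at \<open>0\<close> is \<open>\<rho>(d) \<omega>(d)\<^sup>-\<^sup>1\<close>.\<close>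

lemma sections_of_K:
  assumes p: "CARD('p) \<noteq> 2" and g: "g \<in> carrier G"
  shows "\<exists>\<kappa>\<in>K. \<forall>w. \<kappa> (x # w) = x # g w"
proof -
  interpret K: normal K G by (rule K_normal)
  have ne: "(1 :: 'p mod_ring) \<noteq> - 1" using p mod_ring_one_eq_minus_one_iff by blast
  have comm_eq: "comm a (act_B f d) w = a (act_B f d (act_A (- 1) (act_B f (- d) w)))"
    if "d \<in> V" for d w
    using that by (simp add: mult_apply inv_act_apply)
  have dC: "comm a (act_B f d) \<in> K" if "d \<in> V" for d
    using commutator_in_K that p by (simp add: C_def)
  have A: "\<exists>\<kappa>\<in>K. \<forall>w. \<kappa> (0 # w) = 0 # act_A k w" for k
  proof -
    \<comment> \<open>Conjugation by the inverse of \<open>a\<close> brings the section \<omega>(d)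
      of [a, d] from the letter 1 to 0.\<close>
    let ?\<kappa> = "act_A (- 1) \<otimes>\<^bsub>G\<^esub> comm a (act_B f (k \<cdot>\<^sub>v b_last)) \<otimes>\<^bsub>G\<^esub> inv\<^bsub>G\<^esub> (act_A (- 1))"
    have "?\<kappa> \<in> K" using K.inv_op_closed2[OF _ dC, of "act_A (- 1)"] by simp
    moreover have "?\<kappa> (0 # w) = 0 # act_A k w" for w
      using ne by (simp add: mult_apply[of _ "inv\<^bsub>G\<^esub> (act_A (- 1))"] mult_apply[of "act_A (- 1)"] comm_eq inv_act_apply)
    ultimately show ?thesis by blast
  qed
  have "\<exists>\<kappa>\<in>K. \<forall>w. \<kappa> (0 # w) = 0 # g w"
    using g
  proof (induction g rule: generators_induct)
    case (A k) then show ?case by (rule \<open>\<And>k. \<exists>\<kappa>\<in>K. \<forall>w. \<kappa> (0 # w) = 0 # act_A k w\<close>)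
  next
    case (B c)
    then have "c \<in> rho f ` V" by (simp only: rho_surj)
    then obtain d where d: "c = rho f d" "d \<in> V" by (rule imageE)
    obtain \<kappa> where \<kappa>: "\<kappa> \<in> K" "\<And>w. \<kappa> (0 # w) = 0 # act_A (omega f d) w"
      using A[of "omega f d"] by blast
    \<comment> \<open>The factor \<kappa>, applied first, cancels the inverse of \<omega>(d) and
      leaves \<rho>(d) = c.\<close>
    have "(comm a (act_B f d) \<otimes>\<^bsub>G\<^esub> \<kappa>) (0 # w) = 0 # act_B f c w" for w
      using \<kappa>(2) d by (simp add: mult_apply[of _ \<kappa>] comm_eq omega_uminus)
    then show ?case using K.m_closed[OF dC[OF d(2)] \<kappa>(1)] by blast
  next
    case (mult g h)
    then obtain \<kappa> \<mu> where \<kappa>: "\<kappa> \<in> K" "\<And>w. \<kappa> (0 # w) = 0 # g w" "\<mu> \<in> K" "\<And>w. \<mu> (0 # w) = 0 # h w"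
      by metis
    have "(\<kappa> \<otimes>\<^bsub>G\<^esub> \<mu>) (0 # w) = 0 # (g \<otimes>\<^bsub>G\<^esub> h) w" for w using \<kappa>(2,4) by (simp add: mult_apply)
    then show ?case using K.m_closed[OF \<kappa>(1,3)] by blast
  qed
  then obtain \<kappa> where \<kappa>: "\<kappa> \<in> K" "\<And>w. \<kappa> (0 # w) = 0 # g w" by blast
  have "(act_A x \<otimes>\<^bsub>G\<^esub> \<kappa> \<otimes>\<^bsub>G\<^esub> inv\<^bsub>G\<^esub> (act_A x)) (x # w) = x # g w" for w
    using \<kappa>(2) by (simp add: mult_apply inv_act_apply)
  moreover have "act_A x \<otimes>\<^bsub>G\<^esub> \<kappa> \<otimes>\<^bsub>G\<^esub> inv\<^bsub>G\<^esub> (act_A x) \<in> K"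
    using K.inv_op_closed2[OF _ \<kappa>(1)] by simp
  ultimately show ?thesis by blast
qed

lemma b_last_in_C: "CARD('p) \<noteq> 2 \<or> degree f \<ge> 2 \<Longrightarrow> b_last \<in> C"
  using deg by (auto simp: C_def b_last_def)

text \<open>Choose \<kappa> in \<open>K\<close> with section \<open>g\<close> at the fixed letter
  \<open>x\<close>. Its commutator with the copy of \<open>k\<close> is the copy of [g, k], whatever
  \<kappa> does at other letters.\<close>

lemma commutator_in_sections_derived:
  assumes p: "CARD('p) \<noteq> 2" and g: "g \<in> carrier G" and k: "k \<in> K"
  shows "comm g k \<in> sections_in (derived G K) x"
proof -
  interpret K: normal K G by (rule K_normal)
  have l: "b_last \<in> C" using b_last_in_C p by simp
  obtain \<kappa> where \<kappa>: "\<kappa> \<in> K" "\<And>w. \<kappa> ([x] @ w) = [x] @ g w"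
    using sections_of_K[OF p g, of x] by auto
  have at_k: "at_vertex [x] k \<in> K" "at_vertex [x] (inv\<^bsub>G\<^esub> k) \<in> K" using K_branching[OF l] k by auto
  have "\<kappa> \<otimes>\<^bsub>G\<^esub> at_vertex [x] k \<otimes>\<^bsub>G\<^esub> inv\<^bsub>G\<^esub> \<kappa> = at_vertex [x] (g \<otimes>\<^bsub>G\<^esub> k \<otimes>\<^bsub>G\<^esub> inv\<^bsub>G\<^esub> g)"
    using conjugate_at_vertex[OF _ g \<kappa>(2), of k] \<kappa>(1) k at_k by simp
  moreover have "inv\<^bsub>G\<^esub> at_vertex [x] k = at_vertex [x] (inv\<^bsub>G\<^esub> k)"
    using at_vertex_inv[of k "[x]"] k at_k by simp
  ultimately have "comm \<kappa> (at_vertex [x] k) = at_vertex [x] (comm g k)"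
    by (simp only: at_vertex_mult)
  moreover have "comm \<kappa> (at_vertex [x] k) \<in> derived G K"
    unfolding derived_def using \<kappa>(1) at_k(1) by (intro generate.incl) blast
  ultimately show ?thesis using g k by (simp add: sections_in_def)
qed

text \<open>One level down, the pullback \<open>?L\<close> contains all commutators of
  \<open>G\<close> with \<open>K\<close>. For odd p the set \<open>C\<close> is all of
  \<open>V\<close>, so in the quotient by \<open>?L\<close> every [a, y] is central and
  \<open>finite_if_central_commutators\<close> applies.\<close>

lemma finite_index_derived_odd:
  assumes p: "CARD('p) \<noteq> 2"
  shows "finite (carrier (G Mod (derived G K)))"
proof (rule finite_index_step)
  interpret K: normal K G by (rule K_normal)
  show D: "derived G K \<lhd> G" by (rule G.derived_is_normal[OF K_normal])
  fix x
  let ?L = "sections_in (derived G K) x"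
  interpret L: normal ?L G by (rule normal_sections_in[OF D])
  interpret Q: group "G Mod ?L" by (rule L.factorgroup_is_group)
  interpret \<pi>: group_hom G "G Mod ?L" "\<lambda>g. ?L #>\<^bsub>G\<^esub> g" by (rule L.group_hom_FactGroup)
  let ?\<pi> = "\<lambda>g. ?L #>\<^bsub>G\<^esub> g"
  have VC: "V = C" using p by (auto simp: C_def)
  show "finite (carrier (G Mod ?L))"
  proof (rule Q.finite_if_central_commutators)
    show "?\<pi> a \<in> carrier (G Mod ?L)" by (rule \<pi>.hom_closed) simp
    show "CARD('p) > 0" by simp
    have "a [^]\<^bsub>G\<^esub> CARD('p) = \<one>\<^bsub>G\<^esub>" by (simp only: a_pow of_nat_card_eq_0 act_A_0 one_eq)
    then show "?\<pi> a [^]\<^bsub>G Mod ?L\<^esub> CARD('p) = \<one>\<^bsub>G Mod ?L\<^esub>"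
      using \<pi>.hom_nat_pow[of a "CARD('p)"] \<pi>.hom_one act_A_in by metis
    have "subgroup (act_B f ` V) G" by (rule subgroup_act_B) auto
    then show "subgroup (?\<pi> ` act_B f ` V) (G Mod ?L)" by (rule \<pi>.subgroup_img_is_subgroup)
    show "finite (?\<pi> ` act_B f ` V)" using finite_V by simp
    show "carrier (G Mod ?L) = generate (G Mod ?L) (insert (?\<pi> a) (?\<pi> ` act_B f ` V))"
    proof -
      have "insert a (act_B f ` V) \<subseteq> carrier G" by auto
      from L.generate_FactGroup[OF this carrier_eq_generate_a] show ?thesis by (simp only: image_insert)
    qed
  next
    fix \<beta> \<gamma> assume "\<beta> \<in> ?\<pi> ` act_B f ` V" "\<gamma> \<in> ?\<pi> ` act_B f ` V"
    then obtain c d where cd: "c \<in> V" "d \<in> V" "\<beta> = ?\<pi> (act_B f c)" "\<gamma> = ?\<pi> (act_B f d)" by blast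
    then show "\<beta> \<otimes>\<^bsub>G Mod ?L\<^esub> \<gamma> = \<gamma> \<otimes>\<^bsub>G Mod ?L\<^esub> \<beta>"
      using act_B_commute \<pi>.hom_mult act_B_in by metis
  next
    fix \<beta> \<gamma> assume "\<beta> \<in> ?\<pi> ` act_B f ` V" "\<gamma> \<in> carrier (G Mod ?L)"
    then obtain c g where c: "c \<in> V" "\<beta> = ?\<pi> (act_B f c)" and g: "g \<in> carrier G" "\<gamma> = ?\<pi> g"
      unfolding L.carrier_FactGroup_eq by blast
    let ?k = "comm a (act_B f c)"
    have k: "?k \<in> K" using commutator_in_K c VC by simp
    then have kc: "?k \<in> carrier G" by simp
    have ac: "a \<in> carrier G" "act_B f c \<in> carrier G" using c by auto
    have "?\<pi> ?k = ?\<pi> a \<otimes>\<^bsub>G Mod ?L\<^esub> \<beta> \<otimes>\<^bsub>G Mod ?L\<^esub> inv\<^bsub>G Mod ?L\<^esub> ?\<pi> a \<otimes>\<^bsub>G Mod ?L\<^esub> inv\<^bsub>G Mod ?L\<^esub> \<beta>"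
      unfolding c(2) using ac by (simp only: \<pi>.hom_mult \<pi>.hom_inv G.m_closed G.inv_closed)
    moreover have "?\<pi> (g \<otimes>\<^bsub>G\<^esub> ?k) = ?\<pi> (?k \<otimes>\<^bsub>G\<^esub> g)"
    proof (rule iffD2[OF G.rcoset_eq_iff[OF L.subgroup_axioms]])
      have "comm g ?k \<in> ?L" by (rule commutator_in_sections_derived[OF p g(1) k])
      moreover have "comm g ?k = (g \<otimes>\<^bsub>G\<^esub> ?k) \<otimes>\<^bsub>G\<^esub> inv\<^bsub>G\<^esub> (?k \<otimes>\<^bsub>G\<^esub> g)"
        unfolding G.inv_mult_group[OF kc g(1)] using kc g(1) by (metis G.inv_closed G.m_assoc G.m_closed)
      ultimately show "(g \<otimes>\<^bsub>G\<^esub> ?k) \<otimes>\<^bsub>G\<^esub> inv\<^bsub>G\<^esub> (?k \<otimes>\<^bsub>G\<^esub> g) \<in> ?L" by simp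
    qed (use kc g in \<open>simp_all only: G.m_closed\<close>)
    ultimately show "(?\<pi> a \<otimes>\<^bsub>G Mod ?L\<^esub> \<beta> \<otimes>\<^bsub>G Mod ?L\<^esub> inv\<^bsub>G Mod ?L\<^esub> ?\<pi> a \<otimes>\<^bsub>G Mod ?L\<^esub> inv\<^bsub>G Mod ?L\<^esub> \<beta>) \<otimes>\<^bsub>G Mod ?L\<^esub> \<gamma>
      = \<gamma> \<otimes>\<^bsub>G Mod ?L\<^esub> (?\<pi> a \<otimes>\<^bsub>G Mod ?L\<^esub> \<beta> \<otimes>\<^bsub>G Mod ?L\<^esub> inv\<^bsub>G Mod ?L\<^esub> ?\<pi> a \<otimes>\<^bsub>G Mod ?L\<^esub> inv\<^bsub>G Mod ?L\<^esub> \<beta>)"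
      using g kc \<pi>.hom_mult by metis
  qed
qed

section \<open>The derived subgroup of \<open>K\<close>, even case\<close>

lemma section_pow:
  assumes "t \<in> carrier G" "s \<in> carrier G" "\<And>w. t (x # w) = x # s w"
  shows "(t [^]\<^bsub>G\<^esub> (n::nat)) (x # w) = x # (s [^]\<^bsub>G\<^esub> n) w"
proof (induction n arbitrary: w)
  case 0
  show ?case by (simp add: one_eq)
next
  case (Suc n)
  then show ?case by (simp add: mult_apply assms(3))
qed

lemma double_zero: "CARD('p) = 2 \<Longrightarrow> (x :: 'p mod_ring) + x = 0"
  using mod_ring_two_cases[of x] mod_ring_one_eq_minus_one_iff[where 'p = 'p] by (auto simp: eq_neg_iff_add_eq_0)

lemma act_B_involution:
  assumes "CARD('p) = 2" "c \<in> V"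
  shows "act_B f c \<otimes>\<^bsub>G\<^esub> act_B f c = \<one>\<^bsub>G\<^esub>"
proof -
  have "c + c = 0\<^sub>v (degree f)" by (rule eq_vecI) (use assms double_zero in auto)
  then show ?thesis using act_B_comp[OF assms(2,2)] by (simp add: mult_eq act_B_0 one_eq)
qed

lemma act_A_involution: "CARD('p) = 2 \<Longrightarrow> act_A k \<otimes>\<^bsub>G\<^esub> act_A k = \<one>\<^bsub>G\<^esub>"
  by (simp add: mult_eq act_A_comp double_zero act_A_0 one_eq)

text \<open>The square of \<open>a y\<close> has the sections \<open>\<rho>(y) \<omega>(y)\<close> and \<open>\<omega>(y) \<rho>(y)\<close>. If \<open>\<omega>(y)\<close> is trivial these have
  order at most two, and otherwise both are conjugate to \<open>a \<rho>(y)\<close>.\<close>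

lemma square_torsion:
  assumes p: "CARD('p) = 2" and y: "y \<in> V"
    and n: "(act_A (omega f y) \<otimes>\<^bsub>G\<^esub> act_B f (rho f y)) [^]\<^bsub>G\<^esub> (n::nat) = \<one>\<^bsub>G\<^esub>"
  shows "(a \<otimes>\<^bsub>G\<^esub> act_B f y) [^]\<^bsub>G\<^esub> (2 * n) = \<one>\<^bsub>G\<^esub>"
proof -
  define t where "t = a \<otimes>\<^bsub>G\<^esub> act_B f y"
  define s where "s = act_A (omega f y)"
  define r where "r = act_B f (rho f y)"
  have c: "t \<in> carrier G" "s \<in> carrier G" "r \<in> carrier G" using y by (simp_all add: t_def s_def r_def)
  have m1: "(- 1 :: 'p mod_ring) = 1" using p mod_ring_one_eq_minus_one_iff[where 'p = 'p] by simp
  have two: "(1 :: 'p mod_ring) + 1 = 0" by (rule double_zero[OF p])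
  have t0: "t (0 # w) = 1 # s w" for w by (simp add: t_def s_def mult_apply)
  have t1: "t (1 # w) = 0 # r w" for w
    using two m1 by (simp add: t_def r_def mult_apply)
  have rs: "(s \<otimes>\<^bsub>G\<^esub> r) [^]\<^bsub>G\<^esub> n = \<one>\<^bsub>G\<^esub>" using n by (simp add: s_def r_def)
  \<comment> \<open>The two sections of the square are \<open>s\<close> and \<open>r\<close>
    multiplied in either order, which are conjugate; one torsion hypothesis therefore kills
    both.\<close>
  have "r \<otimes>\<^bsub>G\<^esub> s = inv\<^bsub>G\<^esub> s \<otimes>\<^bsub>G\<^esub> (s \<otimes>\<^bsub>G\<^esub> r) \<otimes>\<^bsub>G\<^esub> inv\<^bsub>G\<^esub> (inv\<^bsub>G\<^esub> s)"
    using c by (simp add: G.m_assoc G.inv_mult_cancel)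
  then have sr: "(r \<otimes>\<^bsub>G\<^esub> s) [^]\<^bsub>G\<^esub> n = \<one>\<^bsub>G\<^esub>"
    using G.nat_pow_conjugate[of "inv\<^bsub>G\<^esub> s" "s \<otimes>\<^bsub>G\<^esub> r" n] rs c by simp
  have tt: "t \<otimes>\<^bsub>G\<^esub> t \<in> carrier G" using c by simp
  have tt0: "((t \<otimes>\<^bsub>G\<^esub> t) [^]\<^bsub>G\<^esub> n) (0 # w) = 0 # w" for w
    using section_pow[OF tt, of "r \<otimes>\<^bsub>G\<^esub> s" 0 n w] c t0 t1 sr by (simp add: mult_apply one_eq)
  have tt1: "((t \<otimes>\<^bsub>G\<^esub> t) [^]\<^bsub>G\<^esub> n) (1 # w) = 1 # w" for w
    using section_pow[OF tt, of "s \<otimes>\<^bsub>G\<^esub> r" 1 n w] c t0 t1 rs by (simp add: mult_apply one_eq)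
  have "(t \<otimes>\<^bsub>G\<^esub> t) [^]\<^bsub>G\<^esub> n = \<one>\<^bsub>G\<^esub>"
  proof
    fix w
    show "((t \<otimes>\<^bsub>G\<^esub> t) [^]\<^bsub>G\<^esub> n) w = \<one>\<^bsub>G\<^esub> w"
    proof (cases w)
      case Nil
      have "(t \<otimes>\<^bsub>G\<^esub> t) [^]\<^bsub>G\<^esub> n \<in> carrier G" using tt by (rule G.nat_pow_closed)
      then show ?thesis using Nil apply_Nil by (simp add: one_eq)
    next
      case (Cons x v)
      then show ?thesis using mod_ring_two_cases[OF p, of x] tt0 tt1 by (auto simp: one_eq)
    qed
  qed
  moreover have "t \<otimes>\<^bsub>G\<^esub> t = t [^]\<^bsub>G\<^esub> (2::nat)" using c by (simp add: numeral_2_eq_2)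
  ultimately show ?thesis using c(1) by (simp add: G.nat_pow_pow t_def[symmetric])
qed

text \<open>Here both sections of the square are \<rho>(y), whose own square is trivial.\<close>

lemma fourth_power_one:
  assumes p: "CARD('p) = 2" and y: "y \<in> V" "omega f y = 0"
  shows "(a \<otimes>\<^bsub>G\<^esub> act_B f y) [^]\<^bsub>G\<^esub> (4::nat) = \<one>\<^bsub>G\<^esub>"
proof -
  have "act_B f (rho f y) [^]\<^bsub>G\<^esub> (2::nat) = \<one>\<^bsub>G\<^esub>"
    using act_B_involution[OF p rho_carrier[of y]] by (simp add: numeral_2_eq_2)
  moreover have "act_A (omega f y) \<otimes>\<^bsub>G\<^esub> act_B f (rho f y) = act_B f (rho f y)"
    by (simp add: y(2) act_A_0 mult_eq)
  ultimately show ?thesis using square_torsion[OF p y(1), of 2] by simp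
qed

text \<open>As long as \<omega>(y) is 1, a torsion exponent for \<open>a\<close> \<rho>(y) doubles
  to one for \<open>a y\<close>. Walking along the \<rho>-orbit ends at exponent 4 where \<omega>
  vanishes.\<close>

lemma torsion_if_omega_vanishes:
  assumes "CARD('p) = 2" "y \<in> V" "omega f ((rho f ^^ i) y) = 0"
  shows "\<exists>n>(0::nat). (a \<otimes>\<^bsub>G\<^esub> act_B f y) [^]\<^bsub>G\<^esub> n = \<one>\<^bsub>G\<^esub>"
  using assms(2,3)
proof (induction i arbitrary: y)
  case 0
  then show ?case using fourth_power_one[OF assms(1)] by (intro exI[of _ 4]) simp
next
  case (Suc i)
  show ?case
  proof (cases "omega f y = 0")
    case True
    then show ?thesis using fourth_power_one[OF assms(1)] Suc.prems by (intro exI[of _ 4]) simp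
  next
    case False
    then have om: "omega f y = 1" using mod_ring_two_cases[OF assms(1)] by blast
    have "omega f ((rho f ^^ i) (rho f y)) = 0" using Suc.prems(2) by (simp add: funpow_swap1)
    then obtain n where n: "n > (0::nat)" "(a \<otimes>\<^bsub>G\<^esub> act_B f (rho f y)) [^]\<^bsub>G\<^esub> n = \<one>\<^bsub>G\<^esub>"
      using Suc.IH[OF rho_carrier] by blast
    then have "(a \<otimes>\<^bsub>G\<^esub> act_B f y) [^]\<^bsub>G\<^esub> (2 * n) = \<one>\<^bsub>G\<^esub>"
      using square_torsion[OF assms(1) Suc.prems(1)] om by simp
    then show ?thesis using n(1) by (intro exI[of _ "2 * n"]) simp
  qed
qed

lemma rho_pow_carrier: "c \<in> V \<Longrightarrow> (rho f ^^ i) c \<in> V"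
  by (induction i) auto

lemma rho_pow_inj: "c \<in> V \<Longrightarrow> d \<in> V \<Longrightarrow> (rho f ^^ i) c = (rho f ^^ i) d \<Longrightarrow> c = d"
proof (induction i)
  case (Suc i)
  then have "(rho f ^^ i) c = (rho f ^^ i) d"
    using inj_onD[OF inj_on_rho _ rho_pow_carrier[OF Suc.prems(1)] rho_pow_carrier[OF Suc.prems(2)]] by simp
  then show ?case using Suc by simp
qed simp

text \<open>Pigeonhole in the finite set \<open>V\<close>, followed by cancellation. The period is
  written \<open>Suc n\<close> because \<open>torsion_C\<close> returns from \<rho>(c) to
  \<open>c\<close> in \<open>n\<close> steps.\<close>

lemma rho_periodic:
  assumes "c \<in> V"
  shows "\<exists>n. (rho f ^^ Suc n) c = c"
proof -
  have "finite (range (\<lambda>i. (rho f ^^ i) c))"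
    by (rule finite_subset[OF _ finite_V]) (use rho_pow_carrier[OF assms] in blast)
  then have "\<not> inj (\<lambda>i. (rho f ^^ i) c)" using finite_imageD infinite_UNIV_nat by blast
  then obtain i j where ij: "i < j" "(rho f ^^ i) c = (rho f ^^ j) c"
    unfolding inj_def by (metis linorder_neqE_nat)
  define n where "n = j - Suc i"
  have j: "j = i + Suc n" using ij(1) by (simp add: n_def)
  have "(rho f ^^ i) c = (rho f ^^ i) ((rho f ^^ Suc n) c)"
    using ij(2) unfolding j by (simp only: funpow_add comp_apply)
  then have "c = (rho f ^^ Suc n) c"
    by (rule rho_pow_inj[OF assms rho_pow_carrier[OF assms]])
  then show ?thesis by metis
qed

text \<open>Write y = \<rho>(c) with \<omega>(c) = 0. The \<rho>-orbit of \<open>y\<close> comes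
  back to \<open>c\<close>, where \<omega> vanishes.\<close>

lemma torsion_C:
  assumes p: "CARD('p) = 2" and y: "y \<in> C"
  shows "\<exists>n>(0::nat). (a \<otimes>\<^bsub>G\<^esub> act_B f y) [^]\<^bsub>G\<^esub> n = \<one>\<^bsub>G\<^esub>"
proof -
  obtain c where c: "c \<in> V" "rho f c = y" "omega f c = 0" using C_preimage[OF y] p by blast
  obtain n where "(rho f ^^ Suc n) c = c" using rho_periodic[OF c(1)] by blast
  then have "(rho f ^^ n) y = c" using c(2) by (simp add: funpow_swap1)
  then show ?thesis
    using c(3) y C_sub by (intro torsion_if_omega_vanishes[OF p, of _ n]) auto
qed

lemma commutator_eq_square:
  assumes "CARD('p) = 2" "y \<in> V"
  shows "comm a (act_B f y) = (a \<otimes>\<^bsub>G\<^esub> act_B f y) [^]\<^bsub>G\<^esub> (2::nat)"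
proof -
  have "inv\<^bsub>G\<^esub> a = a" "inv\<^bsub>G\<^esub> act_B f y = act_B f y"
    using act_A_involution[of 1] act_B_involution assms by (auto intro!: G.inv_equality)
  then show ?thesis using assms(2) by (simp add: numeral_2_eq_2 G.m_assoc)
qed

abbreviation "b_0 \<equiv> unit_vec (degree f) 0 :: 'p mod_ring vec"

text \<open>For p = 2 the set \<open>C\<close> is the hyperplane of vectors with coordinate 0 equal
  to zero, and \<open>b_0\<close> represents its other coset.\<close>

lemma carrier_eq_generate_even:
  assumes p: "CARD('p) = 2"
  shows "carrier G = generate G (insert a (insert (act_B f b_0) (act_B f ` C)))" (is "_ = generate G ?S")
proof
  have S: "?S \<subseteq> carrier G" using C_sub by auto
  then show "generate G ?S \<subseteq> carrier G" by (rule G.generate_incl)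
  interpret S: subgroup "generate G ?S" G by (rule G.generate_is_subgroup[OF S])
  have "act_B f y \<in> generate G ?S" if y: "y \<in> V" for y
  proof (cases "y \<in> C")
    case True
    then show ?thesis by (intro generate.incl) auto
  next
    case False
    then have y0: "y $ 0 = 1" using y p mod_ring_two_cases[OF p, of "y $ 0"] by (auto simp: C_def)
    define c where "c = y - b_0"
    have c: "c \<in> C" using y y0 deg by (auto simp: C_def c_def)
    have "b_0 + c = y" using y by (intro eq_vecI) (auto simp: c_def)
    then have "act_B f y = act_B f b_0 \<otimes>\<^bsub>G\<^esub> act_B f c"
      using act_B_comp[of b_0 c] c C_sub by (auto simp: mult_eq)
    moreover have "act_B f b_0 \<in> generate G ?S" "act_B f c \<in> generate G ?S"
      using c by (auto intro!: generate.incl)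
    ultimately show ?thesis by simp
  qed
  then have "insert a (act_B f ` V) \<subseteq> generate G ?S" by (auto intro: generate.incl)
  then show "carrier G \<subseteq> generate G ?S"
    by (subst carrier_eq_generate_a) (rule G.generate_subgroup_incl[OF _ S.subgroup_axioms])
qed

lemma subgroup_C: "subgroup (act_B f ` C) G"
  by (rule subgroup_act_B) (use deg in \<open>auto simp: C_def\<close>)

text \<open>In the quotient \<open>C\<close> is central and \<open>a\<close> and \<open>b_0\<close>
  are involutions. As m is at least 2, \<omega> vanishes on \<open>b_0\<close>, so the fourth power
  of their product is trivial and \<open>finite_if_involutions\<close> applies.\<close>

lemma finite_index_K_even:
  assumes p: "CARD('p) = 2" and m: "degree f \<ge> 2"
  shows "finite (carrier (G Mod K))"
proof -
  interpret K: normal K G by (rule K_normal)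
  interpret Q: group "G Mod K" by (rule K.factorgroup_is_group)
  interpret \<pi>: group_hom G "G Mod K" "\<lambda>g. K #>\<^bsub>G\<^esub> g" by (rule K.group_hom_FactGroup)
  let ?\<pi> = "\<lambda>g. K #>\<^bsub>G\<^esub> g"
  let ?b = "act_B f b_0"
  have b: "?b \<in> carrier G" by simp
  have a: "a \<in> carrier G" by simp
  have om: "omega f b_0 = 0" using m by (simp add: omega_def)
  have sq: "?\<pi> x \<otimes>\<^bsub>G Mod K\<^esub> ?\<pi> x = \<one>\<^bsub>G Mod K\<^esub>" if "x \<in> carrier G" "x \<otimes>\<^bsub>G\<^esub> x = \<one>\<^bsub>G\<^esub>" for x
    using that \<pi>.hom_mult \<pi>.hom_one by metis
  have four: "(?\<pi> a \<otimes>\<^bsub>G Mod K\<^esub> ?\<pi> ?b) [^]\<^bsub>G Mod K\<^esub> (4::nat) = \<one>\<^bsub>G Mod K\<^esub>"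
    using fourth_power_one[OF p _ om] \<pi>.hom_mult[OF a b] \<pi>.hom_one
      \<pi>.hom_nat_pow[of "a \<otimes>\<^bsub>G\<^esub> ?b" 4] G.m_closed[OF a b] unit_vec_carrier by metis
  have central: "\<forall>z\<in>?\<pi> ` act_B f ` C. \<forall>h\<in>carrier (G Mod K). z \<otimes>\<^bsub>G Mod K\<^esub> h = h \<otimes>\<^bsub>G Mod K\<^esub> z"
  proof (intro ballI)
    fix z h assume "z \<in> ?\<pi> ` act_B f ` C" "h \<in> carrier (G Mod K)"
    then obtain c g where c: "c \<in> C" "z = ?\<pi> (act_B f c)" and g: "g \<in> carrier G" "h = ?\<pi> g"
      unfolding K.carrier_FactGroup_eq by blast
    let ?k = "act_B f c"
    have k: "?k \<in> carrier G" using c C_sub by auto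
    have "?\<pi> (g \<otimes>\<^bsub>G\<^esub> ?k) = ?\<pi> (?k \<otimes>\<^bsub>G\<^esub> g)"
    proof (rule iffD2[OF G.rcoset_eq_iff[OF K.subgroup_axioms]])
      have "comm g ?k \<in> K" by (rule commutator_with_C_in_K[OF c(1) g(1)])
      then show "(g \<otimes>\<^bsub>G\<^esub> ?k) \<otimes>\<^bsub>G\<^esub> inv\<^bsub>G\<^esub> (?k \<otimes>\<^bsub>G\<^esub> g) \<in> K"
        using k g(1) by (simp add: G.inv_mult_group G.m_assoc)
    qed (use k g in \<open>simp_all only: G.m_closed\<close>)
    then show "z \<otimes>\<^bsub>G Mod K\<^esub> h = h \<otimes>\<^bsub>G Mod K\<^esub> z"
      using c(2) g k \<pi>.hom_mult by metis
  qed
  show ?thesis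
  proof (rule Q.finite_if_involutions[OF _ _ _ _ _ four])
    show "?\<pi> a \<in> carrier (G Mod K)" "?\<pi> ?b \<in> carrier (G Mod K)"
      using a b by (auto simp: K.carrier_FactGroup_eq)
    show "?\<pi> a \<otimes>\<^bsub>G Mod K\<^esub> ?\<pi> a = \<one>\<^bsub>G Mod K\<^esub>" by (rule sq[OF a act_A_involution[OF p]])
    show "?\<pi> ?b \<otimes>\<^bsub>G Mod K\<^esub> ?\<pi> ?b = \<one>\<^bsub>G Mod K\<^esub>" by (rule sq[OF b act_B_involution[OF p]]) simp
    show "(0::nat) < 4" by simp
    show "subgroup (?\<pi> ` act_B f ` C) (G Mod K)" by (rule \<pi>.subgroup_img_is_subgroup[OF subgroup_C])
    show "finite (?\<pi> ` act_B f ` C)" using finite_subset[OF C_sub finite_V] by simp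
    show "\<forall>z\<in>?\<pi> ` act_B f ` C. \<forall>h\<in>carrier (G Mod K). z \<otimes>\<^bsub>G Mod K\<^esub> h = h \<otimes>\<^bsub>G Mod K\<^esub> z"
      by (rule central)
    have "insert a (insert ?b (act_B f ` C)) \<subseteq> carrier G" using C_sub by auto
    from K.generate_FactGroup[OF this carrier_eq_generate_even[OF p]]
    show "carrier (G Mod K) = generate (G Mod K) (insert (?\<pi> a) (insert (?\<pi> ?b) (?\<pi> ` act_B f ` C)))"
      by (simp only: image_insert)
  qed
qed

text \<open>For p = 2 the commutator [a, y] is the square of \<open>a y\<close>, so the generators
  of \<open>K\<close> inherit torsion from \<open>torsion_C\<close>, as
  \<open>finite_FactGroup_derived\<close> requires.\<close>

lemma finite_index_derived_even:
  assumes p: "CARD('p) = 2" and m: "degree f \<ge> 2"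
  shows "finite (carrier (G Mod (derived G K)))"
proof (rule G.finite_FactGroup_derived[OF K_normal finite_index_K_even[OF p m] K_def])
  show "finite ((\<lambda>y. comm a (act_B f y)) ` C)" using finite_subset[OF C_sub finite_V] by simp
  show "(\<lambda>y. comm a (act_B f y)) ` C \<subseteq> carrier G" by (rule commutators_carrier)
  fix e assume "e \<in> (\<lambda>y. comm a (act_B f y)) ` C"
  then obtain y where y: "y \<in> C" "e = comm a (act_B f y)" by blast
  then have yV: "y \<in> V" using C_sub by auto
  have c: "a \<otimes>\<^bsub>G\<^esub> act_B f y \<in> carrier G" using yV by simp
  obtain n where n: "n > (0::nat)" "(a \<otimes>\<^bsub>G\<^esub> act_B f y) [^]\<^bsub>G\<^esub> n = \<one>\<^bsub>G\<^esub>"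
    using torsion_C[OF p y(1)] by blast
  have "e [^]\<^bsub>G\<^esub> n = (a \<otimes>\<^bsub>G\<^esub> act_B f y) [^]\<^bsub>G\<^esub> (n * 2)"
    unfolding y(2) commutator_eq_square[OF p yV] using c by (simp add: G.nat_pow_pow mult.commute)
  also have "\<dots> = \<one>\<^bsub>G\<^esub>" using c n(2) by (simp add: G.nat_pow_pow[symmetric])
  finally show "\<exists>n>(0::nat). e [^]\<^bsub>G\<^esub> n = \<one>\<^bsub>G\<^esub>" using n(1) by blast
qed

text \<open>For p = 2 and m = 1 the hyperplane \<open>C\<close> is zero, so \<open>K\<close> is
  trivial and of no help; the two involutions \<open>a\<close> and \<open>b_0\<close> generate the
  group.\<close>

lemma finite_quotient_dihedral:
  assumes p: "CARD('p) = 2" and m: "degree f = 1" and N: "N \<lhd> G" "N \<noteq> {\<one>\<^bsub>G\<^esub>}"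
  shows "finite (carrier (G Mod N))"
proof (rule G.finite_FactGroup_dihedral[OF _ _ _ _ _ N])
  show "a \<in> carrier G" "act_B f b_0 \<in> carrier G" by simp_all
  show "a \<otimes>\<^bsub>G\<^esub> a = \<one>\<^bsub>G\<^esub>" by (rule act_A_involution[OF p])
  show "act_B f b_0 \<otimes>\<^bsub>G\<^esub> act_B f b_0 = \<one>\<^bsub>G\<^esub>" by (rule act_B_involution[OF p]) simp
  have S: "{a, act_B f b_0} \<subseteq> carrier G" by simp
  interpret S: subgroup "generate G {a, act_B f b_0}" G by (rule G.generate_is_subgroup[OF S])
  have "act_B f y = \<one>\<^bsub>G\<^esub>" if "y \<in> C" for y
  proof -
    have "y = 0\<^sub>v (degree f)" using that p m by (intro eq_vecI) (auto simp: C_def)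
    then show ?thesis by (simp add: act_B_0 one_eq)
  qed
  then have "insert a (insert (act_B f b_0) (act_B f ` C)) \<subseteq> generate G {a, act_B f b_0}"
    using S.one_closed by (auto intro: generate.incl)
  then have "carrier G \<subseteq> generate G {a, act_B f b_0}"
    by (subst carrier_eq_generate_even[OF p]) (rule G.generate_subgroup_incl[OF _ S.subgroup_axioms])
  then show "carrier G = generate G {a, act_B f b_0}"
    using G.generate_incl[OF S] by (rule subset_antisym)
qed

lemma finite_quotient:
  assumes N: "N \<lhd> G" "N \<noteq> {\<one>\<^bsub>G\<^esub>}"
  shows "finite (carrier (G Mod N))"
proof (cases "CARD('p) = 2 \<and> degree f = 1")
  case True
  then show ?thesis using finite_quotient_dihedral N by blast
next
  case False
  \<comment> \<open>Outside the dihedral case \<open>b_last\<close> lies in \<open>C\<close>, which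
    makes \<open>K\<close> branching.\<close>
  then have "CARD('p) \<noteq> 2 \<or> degree f \<ge> 2" using deg by linarith
  then have "b_last \<in> C" "finite (carrier (G Mod (derived G K)))"
    using b_last_in_C finite_index_derived_odd finite_index_derived_even by blast+
  then show ?thesis using finite_quotient_if_branching[OF K_normal K_branching _ N] by blast
qed

end

theorem theorem1p3:
  fixes f :: "'p::prime_card mod_ring poly"
  assumes "lead_coeff f = 1"
    and "degree f \<ge> 1"
    and "coeff f 0 \<noteq> 0"
  shows "just_infinite (sunic_group f)"
proof -
  interpret sunic f using assms by unfold_locales
  show ?thesis
    unfolding just_infinite_def using G.is_group infinite_G finite_quotient by blast
qed

end
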